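(* The model-checking problem for stateless probabilistic pushdown systems (pBPA) against probabilistic computational tree logic (PCTL) is undecidable: there is no algorithm which, given a pBPA $\triangle=(\Gamma,\delta,\mathcal{P})$, a simple regular assignment $\nu$, a configuration $\gamma\in\Gamma^*$ and a PCTL state formula $\Psi$, decides whether $\mathcal{M}_{\triangle},\gamma\models^{\nu}\Psi$.
   Context: A (discrete) Markov chain is a triple $\mathcal{M}=(S,\delta,\mathcal{P})$ with $S$ a finite or countably infinite set of states, $\delta\subseteq S\times S$ a transition relation such that every $s$ has some $(s,t)\in\delta$, and $\mathcal{P}:\delta\to(0,1]$ with $\sum_t\mathcal{P}(s,t)=1$ for every $s$. A run is an infinite path $\pi=s_0s_1\cdots$ with $(s_i,s_{i+1})\in\delta$; $\pi(i)=s_i$. For each $s$, the set $Run(s)$ of runs starting in $s$ carries the $\sigma$-field generated by cylinders $Cyl(\pi)$ ($\pi$ a finite path from $s$) and the unique probability measure with $\mathcal{P}(Cyl(s_1\cdots s_k))=\prod_{i=1}^{k-1}\mathcal{P}(s_i,s_{i+1})$. A stateless probabilistic pushdown system (pBPA) is a triple $\triangle=(\Gamma,\delta,\mathcal{P})$ with $\Gamma$ a finite stack alphabet, $\delta$ a finite set of rules $X\to\alpha$ with $X\in\Gamma$, $\alpha\in\Gamma^*$, $|\alpha|\le 2$, at least one rule for each $X$, and $\mathcal{P}$ assigning each rule a (rational) probability with $\sum_\alpha\mathcal{P}(X\to\alpha)=1$ for each $X$. Configurations are words in $\Gamma^*$ (the stack, top at the left); the rule $X\to\alpha$ takes $X\beta$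 to $\alpha\beta$ with probability $\mathcal{P}(X\to\alpha)$. This induces an infinite-state Markov chain $\mathcal{M}_{\triangle}$ on configurations. PCTL over a set $AP$ of atomic propositions: state formulas $\Phi::=p\mid\neg\Phi\mid\Phi_1\wedge\Phi_2\mid\mathcal{P}_{\bowtie r}(\varphi)$, path formulas $\varphi::={\bf X}\Phi\mid\Phi_1{\bf U}\Phi_2$, with $p\in AP$, $\bowtie\in\{>,=\}$, $r\in[0,1]$ rational; ${\bf true}$ abbreviates a tautology. Semantics w.r.t. an assignment $\nu:AP\to 2^S$: $s\models p$ iff $s\in\nu(p)$; Boolean connectives as usual; $s\models\mathcal{P}_{\bowtie r}(\varphi)$ iff $\mathcal{P}(\{\pi\in Run(s):\pi\models\varphi\})\bowtie r$; $\pi\models{\bf X}\Phi$ iff $\pi(1)\models\Phi$; $\pi\models\Phi_1{\bf U}\Phi_2$ iff there is $k\ge0$ with $\pi(k)\models\Phi_2$ and $\pi(j)\models\Phi_1$ for all $0\le j<k$. An assignment $\nu:AP\to 2^{\Gamma^*}$ is regular if each $\nu(p)$ is a regular set of configurations, and simple if for each $p$ there is a set $H_p\subseteq\Gamma$ of heads such that $\gamma\beta\in\nu(p)$ iff $\gamma\in H_p$ (i.e. $p$ holds exactly at configurations whose top symbol is in $H_p$). *)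

theory Defs
  imports "HOL-Probability.Probability" "HOL-Library.Nat_Bijection"
begin

record 's markov_chain =
  states :: "'s set"
  transitions :: "('s \<times> 's) set"
  transition_prob :: "'s \<times> 's \<Rightarrow> real"

definition is_markov_chain :: "'s markov_chain \<Rightarrow> bool" where
  "is_markov_chain M \<longleftrightarrow>
     countable (states M) \<and>
     transitions M \<subseteq> states M \<times> states M \<and>
     (\<forall>s\<in>states M. \<exists>t. (s, t) \<in> transitions M) \<and>
     (\<forall>e\<in>transitions M. 0 < transition_prob M e \<and> transition_prob M e \<le> 1) \<and>
     (\<forall>s\<in>states M. ((\<lambda>t. transition_prob M (s, t)) has_sum 1) {t. (s, t) \<in> transitions M})"

definition Run :: "'s markov_chain \<Rightarrow> 's \<Rightarrow> (nat \<Rightarrow> 's) set" where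
  "Run M s = {\<pi>. \<pi> 0 = s \<and> (\<forall>i. (\<pi> i, \<pi> (Suc i)) \<in> transitions M)}"

definition finite_path :: "'s markov_chain \<Rightarrow> 's \<Rightarrow> 's list \<Rightarrow> bool" where
  "finite_path M s xs \<longleftrightarrow>
     xs \<noteq> [] \<and> hd xs = s \<and> (\<forall>i. Suc i < length xs \<longrightarrow> (xs ! i, xs ! Suc i) \<in> transitions M)"

definition Cyl :: "'s markov_chain \<Rightarrow> 's \<Rightarrow> 's list \<Rightarrow> (nat \<Rightarrow> 's) set" where
  "Cyl M s xs = {\<pi> \<in> Run M s. \<forall>i<length xs. \<pi> i = xs ! i}"

definition is_run_measure :: "'s markov_chain \<Rightarrow> 's \<Rightarrow> (nat \<Rightarrow> 's) measure \<Rightarrow> bool" where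
  "is_run_measure M s \<mu> \<longleftrightarrow>
     prob_space \<mu> \<and>
     space \<mu> = Run M s \<and>
     sets \<mu> = sigma_sets (Run M s) {Cyl M s xs |xs. finite_path M s xs} \<and>
     (\<forall>xs. finite_path M s xs \<longrightarrow>
        emeasure \<mu> (Cyl M s xs) = ennreal (\<Prod>i<length xs - 1. transition_prob M (xs ! i, xs ! Suc i)))"

text \<open>The description below is proper for every state of a Markov chain; see
  \<open>ex1_run_measure\<close>.\<close>

definition run_measure :: "'s markov_chain \<Rightarrow> 's \<Rightarrow> (nat \<Rightarrow> 's) measure" where
  "run_measure M s = (THE \<mu>. is_run_measure M s \<mu>)"

datatype comparison = Greater | Equal

fun compare :: "comparison \<Rightarrow> real \<Rightarrow> real \<Rightarrow> bool" where
  "compare Greater x r \<longleftrightarrow> x > r"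
| "compare Equal x r \<longleftrightarrow> x = r"

datatype 'p state_formula =
    Atom 'p
  | Neg "'p state_formula"
  | Conj "'p state_formula" "'p state_formula"
  | Prob comparison rat "'p path_formula"
and 'p path_formula =
    Next "'p state_formula"
  | Until "'p state_formula" "'p state_formula"

primrec pctl_state :: "'p set \<Rightarrow> 'p state_formula \<Rightarrow> bool"
  and pctl_path :: "'p set \<Rightarrow> 'p path_formula \<Rightarrow> bool" where
  "pctl_state AP (Atom p) \<longleftrightarrow> p \<in> AP"
| "pctl_state AP (Neg \<Phi>) \<longleftrightarrow> pctl_state AP \<Phi>"
| "pctl_state AP (Conj \<Phi>\<^sub>1 \<Phi>\<^sub>2) \<longleftrightarrow> pctl_state AP \<Phi>\<^sub>1 \<and> pctl_state AP \<Phi>\<^sub>2"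
| "pctl_state AP (Prob c r \<phi>) \<longleftrightarrow> 0 \<le> r \<and> r \<le> 1 \<and> pctl_path AP \<phi>"
| "pctl_path AP (Next \<Phi>) \<longleftrightarrow> pctl_state AP \<Phi>"
| "pctl_path AP (Until \<Phi>\<^sub>1 \<Phi>\<^sub>2) \<longleftrightarrow> pctl_state AP \<Phi>\<^sub>1 \<and> pctl_state AP \<Phi>\<^sub>2"

primrec sat :: "'s markov_chain \<Rightarrow> ('p \<Rightarrow> 's set) \<Rightarrow> 'p state_formula \<Rightarrow> 's \<Rightarrow> bool"
  and path_sat :: "'s markov_chain \<Rightarrow> ('p \<Rightarrow> 's set) \<Rightarrow> 'p path_formula \<Rightarrow> (nat \<Rightarrow> 's) \<Rightarrow> bool" where
  "sat M \<nu> (Atom p) = (\<lambda>s. s \<in> \<nu> p)"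
| "sat M \<nu> (Neg \<Phi>) = (\<lambda>s. \<not> sat M \<nu> \<Phi> s)"
| "sat M \<nu> (Conj \<Phi>\<^sub>1 \<Phi>\<^sub>2) = (\<lambda>s. sat M \<nu> \<Phi>\<^sub>1 s \<and> sat M \<nu> \<Phi>\<^sub>2 s)"
| "sat M \<nu> (Prob c r \<phi>) =
     (\<lambda>s. compare c (measure (run_measure M s) {\<pi> \<in> Run M s. path_sat M \<nu> \<phi> \<pi>}) (of_rat r))"
| "path_sat M \<nu> (Next \<Phi>) = (\<lambda>\<pi>. sat M \<nu> \<Phi> (\<pi> 1))"
| "path_sat M \<nu> (Until \<Phi>\<^sub>1 \<Phi>\<^sub>2) =
     (\<lambda>\<pi>. \<exists>k. sat M \<nu> \<Phi>\<^sub>2 (\<pi> k) \<and> (\<forall>j<k. sat M \<nu> \<Phi>\<^sub>1 (\<pi> j)))"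

record 'a pbpa =
  alphabet :: "'a set"
  rules :: "('a \<times> 'a list) set"
  rule_prob :: "'a \<times> 'a list \<Rightarrow> rat"

definition is_pbpa :: "'a pbpa \<Rightarrow> bool" where
  "is_pbpa D \<longleftrightarrow>
     finite (alphabet D) \<and>
     finite (rules D) \<and>
     (\<forall>(X, \<alpha>)\<in>rules D. X \<in> alphabet D \<and> \<alpha> \<in> lists (alphabet D) \<and> length \<alpha> \<le> 2) \<and>
     (\<forall>X\<in>alphabet D. \<exists>\<alpha>. (X, \<alpha>) \<in> rules D) \<and>
     (\<forall>\<rho>\<in>rules D. 0 < rule_prob D \<rho> \<and> rule_prob D \<rho> \<le> 1) \<and>
     (\<forall>X\<in>alphabet D. (\<Sum>\<alpha> | (X, \<alpha>) \<in> rules D. rule_prob D (X, \<alpha>)) = 1)"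

text \<open>The empty stack has no rule. As the transition relation of a Markov chain is total, it gets
  the customary self-loop.\<close>

definition pbpa_trans :: "'a pbpa \<Rightarrow> ('a list \<times> 'a list) set" where
  "pbpa_trans D =
     insert ([], []) {(X # \<beta>, \<alpha> @ \<beta>) |X \<alpha> \<beta>. (X, \<alpha>) \<in> rules D \<and> \<beta> \<in> lists (alphabet D)}"

text \<open>Given \<open>(X # \<beta>, \<gamma>)\<close> in \<open>pbpa_trans D\<close>, the word \<open>\<alpha>\<close> with \<open>\<gamma> = \<alpha> @ \<beta>\<close> is unique, namely the
  prefix of \<open>\<gamma>\<close> of length \<open>length \<gamma> - length \<beta>\<close>.\<close>

fun pbpa_prob :: "'a pbpa \<Rightarrow> 'a list \<times> 'a list \<Rightarrow> real" where
  "pbpa_prob D ([], \<gamma>) = 1"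
| "pbpa_prob D (X # \<beta>, \<gamma>) = of_rat (rule_prob D (X, take (length \<gamma> - length \<beta>) \<gamma>))"

definition pbpa_chain :: "'a pbpa \<Rightarrow> 'a list markov_chain" where
  "pbpa_chain D =
     \<lparr>states = lists (alphabet D), transitions = pbpa_trans D, transition_prob = pbpa_prob D\<rparr>"

definition regular_language :: "'a set \<Rightarrow> 'a list set \<Rightarrow> bool" where
  "regular_language \<Sigma> L \<longleftrightarrow>
     (\<exists>(Q :: nat set) q\<^sub>0 F step.
        finite Q \<and> q\<^sub>0 \<in> Q \<and> F \<subseteq> Q \<and> (\<forall>q\<in>Q. \<forall>a\<in>\<Sigma>. step q a \<in> Q) \<and>
        L = {w \<in> lists \<Sigma>. foldl step q\<^sub>0 w \<in> F})"

definition regular_assignment :: "'a set \<Rightarrow> 'p set \<Rightarrow> ('p \<Rightarrow> 'a list set) \<Rightarrow> bool" where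
  "regular_assignment \<Gamma> AP \<nu> \<longleftrightarrow> (\<forall>p\<in>AP. regular_language \<Gamma> (\<nu> p))"

definition simple_assignment :: "'a set \<Rightarrow> 'p set \<Rightarrow> ('p \<Rightarrow> 'a list set) \<Rightarrow> bool" where
  "simple_assignment \<Gamma> AP \<nu> \<longleftrightarrow>
     (\<forall>p\<in>AP. \<exists>H\<subseteq>\<Gamma>. \<nu> p = {X # \<beta> |X \<beta>. X \<in> H \<and> \<beta> \<in> lists \<Gamma>})"

text \<open>Algorithms are Kleene's partial recursive functions: \<open>computes f xs y\<close> states that \<open>f\<close> halts
  on the arguments \<open>xs\<close> with the value \<open>y\<close>. No arities are imposed, which does not enlarge the class
  of functions computed on a fixed number of arguments.\<close>

datatype recf =
    Zero
  | Succ
  | Proj nat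
  | Comp recf "recf list"
  | PrimRec recf recf
  | Mu recf

inductive computes :: "recf \<Rightarrow> nat list \<Rightarrow> nat \<Rightarrow> bool" where
  zero: "computes Zero xs 0"
| succ: "computes Succ [x] (Suc x)"
| proj: "i < length xs \<Longrightarrow> computes (Proj i) xs (xs ! i)"
| comp: "list_all2 (\<lambda>g y. computes g xs y) gs ys \<Longrightarrow> computes f ys z \<Longrightarrow>
    computes (Comp f gs) xs z"
| primrec_0: "computes f xs y \<Longrightarrow> computes (PrimRec f g) (0 # xs) y"
| primrec_Suc: "computes (PrimRec f g) (n # xs) y \<Longrightarrow> computes g (n # y # xs) z \<Longrightarrow>
    computes (PrimRec f g) (Suc n # xs) z"
| mu: "computes f (n # xs) 0 \<Longrightarrow> (\<forall>m<n. \<exists>k. computes f (m # xs) (Suc k)) \<Longrightarrow>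
    computes (Mu f) xs n"

definition rat_encode :: "rat \<Rightarrow> nat" where
  "rat_encode r = (case quotient_of r of (a, b) \<Rightarrow> prod_encode (int_encode a, int_encode b))"

definition pbpa_encode :: "nat pbpa \<Rightarrow> nat" where
  "pbpa_encode D = prod_encode (set_encode (alphabet D),
     set_encode ((\<lambda>(X, \<alpha>). list_encode [X, list_encode \<alpha>, rat_encode (rule_prob D (X, \<alpha>))])
       ` rules D))"

text \<open>A simple assignment is given by its sets of heads, and the heads of \<open>\<nu> p\<close> are the symbols
  \<open>X\<close> with \<open>[X] \<in> \<nu> p\<close>.\<close>

definition assignment_encode :: "nat set \<Rightarrow> nat set \<Rightarrow> (nat \<Rightarrow> nat list set) \<Rightarrow> nat" where
  "assignment_encode \<Gamma> AP \<nu> =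
     set_encode ((\<lambda>p. prod_encode (p, set_encode {X \<in> \<Gamma>. [X] \<in> \<nu> p})) ` AP)"

fun comparison_encode :: "comparison \<Rightarrow> nat" where
  "comparison_encode Greater = 0"
| "comparison_encode Equal = 1"

primrec state_formula_encode :: "nat state_formula \<Rightarrow> nat"
  and path_formula_encode :: "nat path_formula \<Rightarrow> nat" where
  "state_formula_encode (Atom p) = list_encode [0, p]"
| "state_formula_encode (Neg \<Phi>) = list_encode [1, state_formula_encode \<Phi>]"
| "state_formula_encode (Conj \<Phi>\<^sub>1 \<Phi>\<^sub>2) =
     list_encode [2, state_formula_encode \<Phi>\<^sub>1, state_formula_encode \<Phi>\<^sub>2]"
| "state_formula_encode (Prob c r \<phi>) =
     list_encode [3, comparison_encode c, rat_encode r, path_formula_encode \<phi>]"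
| "path_formula_encode (Next \<Phi>) = list_encode [0, state_formula_encode \<Phi>]"
| "path_formula_encode (Until \<Phi>\<^sub>1 \<Phi>\<^sub>2) =
     list_encode [1, state_formula_encode \<Phi>\<^sub>1, state_formula_encode \<Phi>\<^sub>2]"

inductive_cases computes_ZeroE: "computes Zero xs z"
inductive_cases computes_SuccE: "computes Succ xs z"
inductive_cases computes_ProjE: "computes (Proj i) xs z"
inductive_cases computes_CompE: "computes (Comp f gs) xs z"
inductive_cases computes_PrimRec_0E: "computes (PrimRec f g) (0 # xs) z"
inductive_cases computes_PrimRec_SucE: "computes (PrimRec f g) (Suc n # xs) z"
inductive_cases computes_MuE: "computes (Mu f) xs z"

lemma computes_functional: "computes f xs y \<Longrightarrow> computes f xs z \<Longrightarrow> y = z"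
proof (induction f xs y arbitrary: z rule: computes.induct)
  case (zero xs)
  then show ?case by (rule computes_ZeroE) simp
next
  case (succ x)
  then show ?case by (rule computes_SuccE) simp
next
  case (proj i xs)
  from proj.prems show ?case by (rule computes_ProjE) simp
next
  case (comp xs gs ys f z z')
  from comp.prems obtain ys' where ys': "list_all2 (\<lambda>g y. computes g xs y) gs ys'"
    and z': "computes f ys' z'"
    by (rule computes_CompE)
  have len: "length gs = length ys" "length gs = length ys'"
    using list_all2_lengthD[OF comp.IH(1)] list_all2_lengthD[OF ys'] by simp_all
  have "ys = ys'"
  proof (rule nth_equalityI)
    show "length ys = length ys'" using len by simp
    fix i assume "i < length ys"
    with len have i: "i < length gs" by simp
    show "ys ! i = ys' ! i"
      using list_all2_nthD[OF comp.IH(1) i] list_all2_nthD[OF ys' i] by blast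
  qed
  with z' comp.IH(2) show ?case by blast
next
  case (primrec_0 f xs y g)
  from primrec_0.prems have "computes f xs z" by (rule computes_PrimRec_0E)
  then show ?case by (rule primrec_0.IH)
next
  case (primrec_Suc f g n xs y z z')
  from primrec_Suc.prems obtain y'
    where y': "computes (PrimRec f g) (n # xs) y'" and z': "computes g (n # y' # xs) z'"
    by (rule computes_PrimRec_SucE)
  from primrec_Suc.IH(1)[OF y'] z' have "computes g (n # y # xs) z'" by simp
  then show ?case by (rule primrec_Suc.IH(2))
next
  case (mu f n xs)
  from mu.prems have z0: "computes f (z # xs) 0" by (rule computes_MuE)
  from mu.prems have z: "\<forall>m<z. \<exists>k. computes f (m # xs) (Suc k)" by (rule computes_MuE)
  show ?case
  proof (rule linorder_cases[of n z])
    assume "n < z"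
    with z obtain k where "computes f (n # xs) (Suc k)" by blast
    from mu.IH(1)[OF this] show ?thesis by simp
  next
    assume "z < n"
    with mu.IH(2) obtain k where "computes f (z # xs) y \<longrightarrow> Suc k = y" for y by blast
    from this[of 0] z0 show ?thesis by simp
  qed
qed

lemma rat_encode_eq_iff: "rat_encode r = rat_encode s \<longleftrightarrow> r = s"
proof
  assume "rat_encode r = rat_encode s"
  then have "quotient_of r = quotient_of s"
    by (auto simp: rat_encode_def int_encode_eq split: prod.splits)
  then show "r = s" by (simp add: quotient_of_inject_eq)
qed simp

lemma comparison_encode_eq_iff: "comparison_encode c = comparison_encode d \<longleftrightarrow> c = d"
  by (cases c; cases d) auto

lemma formula_encode_inj:
  "state_formula_encode \<Phi> = state_formula_encode \<Phi>' \<Longrightarrow> \<Phi> = \<Phi>'"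
  "path_formula_encode \<phi> = path_formula_encode \<phi>' \<Longrightarrow> \<phi> = \<phi>'"
proof (induction \<Phi> and \<phi> arbitrary: \<Phi>' and \<phi>' rule: state_formula.induct path_formula.induct)
  case (Atom x) then show ?case by (cases \<Phi>') auto
next
  case (Neg x) then show ?case by (cases \<Phi>') auto
next
  case (Conj x y) then show ?case by (cases \<Phi>') auto
next
  case (Prob c r x) then show ?case
    by (cases \<Phi>') (auto simp: rat_encode_eq_iff comparison_encode_eq_iff)
next
  case (Next x) then show ?case by (cases \<phi>') auto
next
  case (Until x y) then show ?case by (cases \<phi>') auto
qed

lemma set_encode_image_inj:
  assumes "set_encode (f ` A) = set_encode (g ` B)" "finite A" "finite B"
  shows "f ` A = g ` B"
  using assms set_encode_eq by auto

lemma pbpa_encode_inj: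
  assumes "is_pbpa D" "is_pbpa D'" "pbpa_encode D = pbpa_encode D'"
  shows "alphabet D = alphabet D'" "rules D = rules D'"
    "\<rho> \<in> rules D \<Longrightarrow> rule_prob D \<rho> = rule_prob D' \<rho>"
proof -
  let ?c = "\<lambda>D (X, \<alpha>). list_encode [X, list_encode \<alpha>, rat_encode (rule_prob D (X, \<alpha>))]"
  have fin: "finite (alphabet D)" "finite (alphabet D')" "finite (rules D)" "finite (rules D')"
    using assms by (auto simp: is_pbpa_def)
  show "alphabet D = alphabet D'"
    using assms(3) fin by (simp add: pbpa_encode_def set_encode_eq)
  have im: "?c D ` rules D = ?c D' ` rules D'"
    using assms(3) fin by (intro set_encode_image_inj) (simp_all add: pbpa_encode_def)
  have *: "\<rho> \<in> rules D' \<and> rule_prob D \<rho> = rule_prob D' \<rho>"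
    if "?c D ` rules D = ?c D' ` rules D'" "\<rho> \<in> rules D" for \<rho> D D'
  proof -
    from that have "?c D \<rho> \<in> ?c D' ` rules D'" by blast
    then show ?thesis
      by (cases \<rho>) (auto simp: list_encode_eq rat_encode_eq_iff)
  qed
  show "rules D = rules D'"
    using *[OF im] *[OF im[symmetric]] by blast
  show "\<rho> \<in> rules D \<Longrightarrow> rule_prob D \<rho> = rule_prob D' \<rho>"
    using *[OF im] by blast
qed

lemma assignment_encode_inj:
  assumes "simple_assignment \<Gamma> AP \<nu>" "simple_assignment \<Gamma> AP' \<nu>'"
    and "finite \<Gamma>" "finite AP" "finite AP'"
    and "assignment_encode \<Gamma> AP \<nu> = assignment_encode \<Gamma> AP' \<nu>'"
  shows "AP = AP'" "p \<in> AP \<Longrightarrow> \<nu> p = \<nu>' p"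
proof -
  let ?h = "\<lambda>\<nu> p. {X \<in> \<Gamma>. [X] \<in> \<nu> p}"
  let ?c = "\<lambda>\<nu> p. prod_encode (p, set_encode (?h \<nu> p))"
  have im: "?c \<nu> ` AP = ?c \<nu>' ` AP'"
    using assms by (intro set_encode_image_inj) (simp_all add: assignment_encode_def)
  have *: "p \<in> AP' \<and> ?h \<nu> p = ?h \<nu>' p" if "?c \<nu> ` AP = ?c \<nu>' ` AP'" "p \<in> AP" for p AP AP' \<nu> \<nu>'
  proof -
    from that have "?c \<nu> p \<in> ?c \<nu>' ` AP'" by blast
    with assms(3) show ?thesis by (auto simp: set_encode_eq)
  qed
  show AP: "AP = AP'"
    using *[OF im] *[OF im[symmetric]] by blast
  assume p: "p \<in> AP"
  have rec: "\<nu> p = {X # \<beta> |X \<beta>. X \<in> ?h \<nu> p \<and> \<beta> \<in> lists \<Gamma>}"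
    if "simple_assignment \<Gamma> AP \<nu>" for \<nu>
  proof -
    from that p obtain H where "H \<subseteq> \<Gamma>" "\<nu> p = {X # \<beta> |X \<beta>. X \<in> H \<and> \<beta> \<in> lists \<Gamma>}"
      unfolding simple_assignment_def by blast
    then show ?thesis by auto
  qed
  show "\<nu> p = \<nu>' p"
    using rec[OF assms(1)] rec[OF assms(2)[folded AP]] *[OF im p] by simp
qed

lemma simple_imp_regular_assignment:
  assumes "simple_assignment \<Gamma> AP \<nu>"
  shows "regular_assignment \<Gamma> AP \<nu>"
  unfolding regular_assignment_def
proof
  fix p assume "p \<in> AP"
  with assms obtain H where H: "H \<subseteq> \<Gamma>" "\<nu> p = {X # \<beta> |X \<beta>. X \<in> H \<and> \<beta> \<in> lists \<Gamma>}"
    unfolding simple_assignment_def by blast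
  define step :: "nat \<Rightarrow> 'a \<Rightarrow> nat"
    where "step q a = (if q = 0 then if a \<in> H then 1 else 2 else q)" for q a
  have const: "foldl step q w = q" if "q \<noteq> 0" for q w
    using that by (induction w) (auto simp: step_def)
  have "foldl step 0 w = 1 \<longleftrightarrow> (\<exists>X \<beta>. w = X # \<beta> \<and> X \<in> H)" for w
    by (cases w) (auto simp: const step_def)
  then have "\<nu> p = {w \<in> lists \<Gamma>. foldl step 0 w \<in> {1}}"
    using H by auto
  then show "regular_language \<Gamma> (\<nu> p)"
    unfolding regular_language_def
    by (intro exI[of _ "{0, 1, 2}"] exI[of _ 0] exI[of _ "{1}"] exI[of _ step])
       (auto simp: step_def)
qed

lemma is_markov_chain_pbpa_chain:
  assumes "is_pbpa D"
  shows "is_markov_chain (pbpa_chain D)"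
proof -
  have rules: "X \<in> alphabet D" "\<alpha> \<in> lists (alphabet D)"
      "0 < rule_prob D (X, \<alpha>)" "rule_prob D (X, \<alpha>) \<le> 1" if "(X, \<alpha>) \<in> rules D" for X \<alpha>
    using assms that unfolding is_pbpa_def by blast+
  have total: "\<exists>\<alpha>. (X, \<alpha>) \<in> rules D" if "X \<in> alphabet D" for X
    using assms that unfolding is_pbpa_def by blast
  have fin_rules: "finite (rules D)"
    using assms unfolding is_pbpa_def by blast
  have succ: "{t. (X # \<beta>, t) \<in> pbpa_trans D} = (\<lambda>\<alpha>. \<alpha> @ \<beta>) ` {\<alpha>. (X, \<alpha>) \<in> rules D}"
    if "\<beta> \<in> lists (alphabet D)" for X \<beta>
    using that by (auto simp: pbpa_trans_def)
  have fin: "finite {\<alpha>. (X, \<alpha>) \<in> rules D}" for X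
    by (rule finite_subset[OF _ finite_imageI[OF fin_rules, of snd]]) (force simp: image_iff)
  have "countable (lists (alphabet D))"
    using assms by (simp add: is_pbpa_def countable_finite)
  moreover have "pbpa_trans D \<subseteq> lists (alphabet D) \<times> lists (alphabet D)"
    using rules(1) rules(2)[unfolded in_lists_conv_set] by (auto simp: pbpa_trans_def)
  moreover have "\<exists>t. (s, t) \<in> pbpa_trans D" if "s \<in> lists (alphabet D)" for s
  proof (cases s)
    case (Cons X \<beta>)
    with that total obtain \<alpha> where "(X, \<alpha>) \<in> rules D" by auto
    with that Cons have "(s, \<alpha> @ \<beta>) \<in> pbpa_trans D" by (auto simp: pbpa_trans_def)
    then show ?thesis ..
  qed (auto simp: pbpa_trans_def)
  moreover have "0 < pbpa_prob D e \<and> pbpa_prob D e \<le> 1" if "e \<in> pbpa_trans D" for e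
    using that rules(3,4) by (auto simp: pbpa_trans_def)
  moreover have "((\<lambda>t. pbpa_prob D (s, t)) has_sum 1) {t. (s, t) \<in> pbpa_trans D}"
    if s: "s \<in> lists (alphabet D)" for s
  proof (cases s)
    case Nil
    then have "{t. (s, t) \<in> pbpa_trans D} = {[]}"
      by (auto simp: pbpa_trans_def)
    with Nil show ?thesis by (simp add: has_sum_finite_iff)
  next
    case (Cons X \<beta>)
    then have \<beta>: "\<beta> \<in> lists (alphabet D)" and X: "X \<in> alphabet D" using s by auto
    have "(\<Sum>t | (s, t) \<in> pbpa_trans D. pbpa_prob D (s, t))
        = (\<Sum>\<alpha> | (X, \<alpha>) \<in> rules D. pbpa_prob D (s, \<alpha> @ \<beta>))"
      unfolding Cons succ[OF \<beta>] by (subst sum.reindex) (auto simp: inj_on_def)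
    also have "\<dots> = of_rat (\<Sum>\<alpha> | (X, \<alpha>) \<in> rules D. rule_prob D (X, \<alpha>))"
      by (simp add: Cons of_rat_sum)
    also have "\<dots> = 1"
      using assms X by (simp add: is_pbpa_def)
    finally show ?thesis
      using fin by (simp add: has_sum_finite_iff Cons succ[OF \<beta>])
  qed
  ultimately show ?thesis
    by (simp add: is_markov_chain_def pbpa_chain_def)
qed

lemma nn_integral_transition_prob:
  assumes M: "is_markov_chain M" and x: "x \<in> states M"
  shows "(\<integral>\<^sup>+t. ennreal (transition_prob M (x, t)) * indicator {t. (x, t) \<in> transitions M} t
           \<partial>count_space (states M)) = 1"
proof -
  let ?A = "{t. (x, t) \<in> transitions M}" and ?f = "\<lambda>t. transition_prob M (x, t)"
  have A: "?A \<subseteq> states M"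
    using M by (auto simp: is_markov_chain_def)
  have nonneg: "0 \<le> ?f t" if "t \<in> ?A" for t
    using M that by (simp add: is_markov_chain_def less_imp_le)
  have sum: "(?f has_sum 1) ?A"
    using M x by (simp add: is_markov_chain_def)
  have "?f summable_on ?A"
    using sum by (rule has_sum_imp_summable)
  then have "Infinite_Set_Sum.abs_summable_on ?f ?A"
    using summable_on_iff_abs_summable_on_real[of ?f ?A] abs_summable_equivalent[of ?f ?A] by blast
  then have "(\<integral>\<^sup>+t. ?f t \<partial>count_space ?A) = ennreal 1"
    using nonneg infsumI[OF sum] by (subst nn_integral_conv_infsetsum) (auto simp: infsetsum_infsum)
  also have "(\<integral>\<^sup>+t. ?f t \<partial>count_space ?A) = (\<integral>\<^sup>+t. ennreal (?f t) * indicator ?A t \<partial>count_space UNIV)"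
    by (rule nn_integral_count_space_indicator) simp
  also have "\<dots> = (\<integral>\<^sup>+t. ennreal (?f t) * indicator ?A t * indicator (states M) t \<partial>count_space UNIV)"
    using A by (intro nn_integral_cong) (auto split: split_indicator)
  also have "\<dots> = (\<integral>\<^sup>+t. ennreal (?f t) * indicator ?A t \<partial>count_space (states M))"
    by (rule nn_integral_count_space_indicator[symmetric]) simp
  finally show ?thesis by simp
qed

lemma ex_run_measure:
  assumes M: "is_markov_chain M" and s: "s \<in> states M"
  shows "\<exists>\<mu>. is_run_measure M s \<mu>"
proof -
  define S where "S = states M"
  define N where "N = count_space S"
  define q where "q x t = ennreal (transition_prob M (x, t)) * indicator {t. (x, t) \<in> transitions M} t" for x t
  define K where "K i \<omega> = (case i of 0 \<Rightarrow> return N s | Suc j \<Rightarrow> density N (q (\<omega> j)))"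
    for i and \<omega> :: "nat \<Rightarrow> 'a"
  define w where "w x i = (case i of 0 \<Rightarrow> indicator {s} (x 0) | Suc j \<Rightarrow> q (x j) (x (Suc j)))"
    for x :: "nat \<Rightarrow> 'a" and i
  have E: "transitions M \<subseteq> S \<times> S" and S: "countable S" and s: "s \<in> S"
    using M s by (auto simp: is_markov_chain_def S_def)
  have prob_q: "prob_space (density N (q x))" if "x \<in> S" for x
  proof (rule prob_spaceI)
    have "emeasure (density N (q x)) (space (density N (q x))) = (\<integral>\<^sup>+t. q x t * indicator S t \<partial>count_space S)"
      by (simp add: emeasure_density N_def)
    also have "\<dots> = (\<integral>\<^sup>+t. q x t \<partial>count_space S)"
      by (intro nn_integral_cong) simp
    also have "\<dots> = 1"
      using nn_integral_transition_prob[OF M, of x] that by (simp add: q_def S_def)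
    finally show "emeasure (density N (q x)) (space (density N (q x))) = 1" .
  qed
  have prob_K: "prob_space (K i \<omega>)" if "\<omega> \<in> space (PiM {0..<i} (\<lambda>_. N))" for i \<omega>
    using that s prob_q
    by (cases i) (auto simp: K_def space_PiM PiE_iff N_def intro!: prob_space_return)
  have meas_K: "K i \<in> measurable (PiM {0..<i} (\<lambda>_. N)) (subprob_algebra N)" for i
  proof (cases i)
    case 0
    then have "K i = (\<lambda>_. return N s)"
      by (simp add: K_def fun_eq_iff)
    moreover have "return N s \<in> space (subprob_algebra N)"
      using s prob_space_return[of s N]
      by (simp add: space_subprob_algebra prob_space_imp_subprob_space N_def)
    ultimately show ?thesis by simp
  next
    case (Suc j)
    have "(\<lambda>x. density N (q x)) \<in> measurable (count_space S) (subprob_algebra N)"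
      using prob_q by (auto simp: measurable_count_space_eq1 space_subprob_algebra
          intro!: prob_space_imp_subprob_space)
    moreover have "(\<lambda>\<omega>. \<omega> j) \<in> measurable (PiM {0..<i} (\<lambda>_. N)) (count_space S)"
      using measurable_component_singleton[of j "{0..<i}" "\<lambda>_. N"] Suc by (simp add: N_def)
    ultimately have "(\<lambda>\<omega>. density N (q (\<omega> j))) \<in> measurable (PiM {0..<i} (\<lambda>_. N)) (subprob_algebra N)"
      by (rule measurable_compose[rotated])
    then show ?thesis
      by (simp add: K_def[abs_def] Suc)
  qed
  interpret IT: Ionescu_Tulcea K "\<lambda>_. N"
    by (rule Ionescu_Tulcea.intro[OF meas_K prob_K])
  have space_N: "space N = S" and sets_N: "sets N = Pow S"
    by (simp_all add: N_def)
  have sing: "{x} \<in> sets (PiM {0..<n} (\<lambda>_. N))" if "x \<in> PiE {0..<n} (\<lambda>_. S)" for x and n :: nat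
  proof -
    have "{x} = PiE {0..<n} (\<lambda>i. {x i})"
      using that by (intro PiE_singleton[symmetric]) (simp add: PiE_iff)
    also have "\<dots> \<in> sets (PiM {0..<n} (\<lambda>_. N))"
      using that by (intro sets_PiM_I_finite) (auto simp: sets_N)
    finally show ?thesis .
  qed
  have K_sing: "emeasure (K n \<omega>) {a} = w (fun_upd \<omega> n a) n" if "a \<in> S" for n \<omega> a
    using that by (cases n)
      (auto simp: K_def w_def emeasure_density sets_N nn_integral_indicator_singleton N_def
        split: split_indicator)
  have C: "emeasure (IT.C 0 n (\<lambda>_. undefined)) {x} = (\<Prod>i<n. w x i)"
    if "x \<in> PiE {0..<n} (\<lambda>_. S)" for n x
    using that
  proof (induction n arbitrary: x)
    case 0
    then show ?case by (auto simp: PiM_empty)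
  next
    case (Suc n)
    let ?u = "\<lambda>_ :: nat. undefined :: 'a" and ?y = "restrict x {0..<n}"
    have y: "?y \<in> PiE {0..<n} (\<lambda>_. S)" and xn: "x n \<in> S"
      using Suc.prems by (auto simp: PiE_iff)
    have eP: "emeasure (IT.eP n \<omega>) {x} = w x n * indicator {?y} \<omega>"
      if "\<omega> \<in> space (PiM {0..<n} (\<lambda>_. N))" for \<omega>
    proof -
      have \<omega>: "\<omega> \<in> PiE {0..<n} (\<lambda>_. S)"
        using that by (simp add: space_PiM space_N)
      have "emeasure (IT.eP n \<omega>) {x} = emeasure (K n \<omega>) ((\<lambda>a. fun_upd \<omega> n a) -` {x} \<inter> S)"
        using IT.emeasure_eP[OF that sing[OF Suc.prems]] by (simp add: space_N)
      also have "\<dots> = w x n * indicator {?y} \<omega>"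
      proof (cases "\<omega> = ?y")
        case True
        have upd: "fun_upd ?y n (x n) = x"
          using Suc.prems by (auto simp: fun_eq_iff PiE_iff extensional_def)
        have "fun_upd \<omega> n a = x \<longleftrightarrow> a = x n" for a
        proof
          assume "fun_upd \<omega> n a = x"
          then show "a = x n" by (metis fun_upd_same)
        qed (use True upd in simp)
        then have "(\<lambda>a. fun_upd \<omega> n a) -` {x} \<inter> S = {x n}"
          using xn by auto
        then show ?thesis
          using K_sing[OF xn, of n \<omega>] True upd by simp
      next
        case False
        have "fun_upd \<omega> n a \<noteq> x" for a
        proof
          assume eq: "fun_upd \<omega> n a = x"
          have "\<omega> i = ?y i" for i
            using \<omega> eq[symmetric] by (auto simp: PiE_iff extensional_def)
          with False show False by auto
        qed
        then have "(\<lambda>a. fun_upd \<omega> n a) -` {x} \<inter> S = {}"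
          by auto
        with False show ?thesis by simp
      qed
      finally show ?thesis .
    qed
    have u: "?u \<in> space (PiM {0..<0} (\<lambda>_. N))"
      by (simp add: space_PiM)
    have sp: "space (IT.C 0 n ?u) = space (PiM {0..<n} (\<lambda>_. N))"
      using IT.space_C[OF u, of n] by simp
    have st: "sets (IT.C 0 n ?u) = sets (PiM {0..<n} (\<lambda>_. N))"
      using IT.sets_C[OF u, of n] by simp
    have ne: "space (IT.C 0 n ?u) \<noteq> {}"
      using y unfolding sp space_PiM space_N by blast
    have "emeasure (IT.C 0 (Suc n) ?u) {x} = (\<integral>\<^sup>+\<omega>. emeasure (IT.eP n \<omega>) {x} \<partial>IT.C 0 n ?u)"
      using ne sing[OF Suc.prems] IT.measurable_eP[of n]
      by (simp add: emeasure_bind[where N = "PiM {0..<Suc n} (\<lambda>_. N)"] measurable_cong_sets[OF st refl])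
    also have "\<dots> = (\<integral>\<^sup>+\<omega>. w x n * indicator {?y} \<omega> \<partial>IT.C 0 n ?u)"
      by (intro nn_integral_cong eP) (simp add: sp)
    also have "\<dots> = w x n * emeasure (IT.C 0 n ?u) {?y}"
      using sing[OF y] by (intro nn_integral_cmult_indicator) (simp add: st)
    also have "emeasure (IT.C 0 n ?u) {?y} = (\<Prod>i<n. w ?y i)"
      by (rule Suc.IH[OF y])
    also have "\<dots> = (\<Prod>i<n. w x i)"
      by (intro prod.cong) (auto simp: w_def split: nat.split)
    finally show ?case by (simp add: mult.commute)
  qed

  define L where "L = IT.PF.lim"
  have sets_L: "sets L = sets (PiM UNIV (\<lambda>_. N))"
    by (simp add: L_def)
  have space_L: "space L = {\<omega>. \<forall>i. \<omega> i \<in> S}"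
    using sets_eq_imp_space_eq[OF sets_L] by (auto simp: space_PiM space_N PiE_iff)
  interpret L: prob_space L
  proof (rule prob_space_distrD)
    show "(\<lambda>\<omega>. restrict \<omega> {0..<0}) \<in> measurable L (PiM {0..<0} (\<lambda>_. N))"
      unfolding measurable_cong_sets[OF sets_L refl] by (rule measurable_restrict_subset) simp
    show "prob_space (distr L (PiM {0..<0} (\<lambda>_. N)) (\<lambda>\<omega>. restrict \<omega> {0..<0}))"
      unfolding L_def by (subst IT.distr_lim) (auto intro: IT.PF.prob_space_P)
  qed
  define B where "B xs = {\<omega> \<in> space L. \<forall>i<length xs. \<omega> i = xs ! i}" for xs
  have B: "B xs \<in> sets L" "emeasure L (B xs) = (\<Prod>i<length xs. w (nth xs) i)"
    if "xs \<in> lists S" for xs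
  proof -
    let ?n = "length xs"
    let ?x = "restrict (nth xs) {0..<?n}"
    have x: "?x \<in> PiE {0..<?n} (\<lambda>_. S)"
      using that by (auto simp: in_lists_conv_set)
    have emb: "IT.PF.emb UNIV {0..<?n} {?x} = B xs"
    proof (intro equalityI subsetI)
      fix \<omega> assume \<omega>: "\<omega> \<in> IT.PF.emb UNIV {0..<?n} {?x}"
      then have "\<omega> \<in> space L" "restrict \<omega> {0..<?n} = ?x"
        by (auto simp: prod_emb_def space_L space_N PiE_iff)
      moreover from this(2) have "\<omega> i = xs ! i" if "i < ?n" for i
        using that by (metis atLeastLessThan_iff restrict_apply' zero_le)
      ultimately show "\<omega> \<in> B xs" by (simp add: B_def)
    qed (auto simp: prod_emb_def B_def space_L space_N PiE_iff fun_eq_iff)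
    show "B xs \<in> sets L"
      unfolding emb[symmetric] sets_L using sing[OF x] by (intro measurable_prod_emb) auto
    have "emeasure L (B xs) = emeasure (IT.CI {0..<?n}) {?x}"
      unfolding L_def emb[symmetric] using sing[OF x] by (intro IT.lim) auto
    also have "\<dots> = emeasure (IT.C 0 ?n (\<lambda>_. undefined)) {?x}"
    proof -
      have "prod_emb {0..<?n} (\<lambda>_. N) {0..<?n} {?x} = {?x}"
        using x by (intro prod_emb_id) (simp add: space_N)
      then show ?thesis
        using sing[OF x] IT.emeasure_CI[of "{0..<?n}" ?n "{?x}"] by simp
    qed
    also have "\<dots> = (\<Prod>i<?n. w ?x i)"
      by (rule C[OF x])
    also have "\<dots> = (\<Prod>i<?n. w (nth xs) i)"
      by (intro prod.cong) (auto simp: w_def split: nat.split)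
    finally show "emeasure L (B xs) = (\<Prod>i<?n. w (nth xs) i)" .
  qed
  have Run_L: "Run M s \<subseteq> space L"
    using E by (auto simp: Run_def space_L)
  define X where "X = {xs \<in> lists S. xs \<noteq> [] \<and> \<not> finite_path M s xs}"
  have "countable X"
    using S by (auto simp: X_def intro: countable_subset[of _ "lists S"])
  have compl: "space L - Run M s = (\<Union>xs\<in>X. B xs)"
  proof (intro equalityI subsetI)
    fix \<omega> assume \<omega>: "\<omega> \<in> space L - Run M s"
    have "\<exists>n. \<not> finite_path M s (map \<omega> [0..<Suc n])"
    proof (rule ccontr)
      assume "\<nexists>n. \<not> finite_path M s (map \<omega> [0..<Suc n])"
      then have fp: "finite_path M s (map \<omega> [0..<Suc n])" for n by blast
      have "\<omega> 0 = s"
        using fp[of 0] by (simp add: finite_path_def)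
      moreover have "(\<omega> i, \<omega> (Suc i)) \<in> transitions M" for i
        using fp[of "Suc i"] by (auto simp: finite_path_def simp del: upt_Suc dest!: spec[of _ i])
      ultimately show False
        using \<omega> by (simp add: Run_def)
    qed
    then obtain n where "\<not> finite_path M s (map \<omega> [0..<Suc n])" ..
    then have "map \<omega> [0..<Suc n] \<in> X" "\<omega> \<in> B (map \<omega> [0..<Suc n])"
      using \<omega> by (auto simp: X_def B_def space_L simp del: upt_Suc)
    then show "\<omega> \<in> (\<Union>xs\<in>X. B xs)" by blast
  next
    fix \<omega> assume "\<omega> \<in> (\<Union>xs\<in>X. B xs)"
    then obtain xs where xs: "xs \<in> X" "\<omega> \<in> B xs" by blast
    have "finite_path M s xs" if "\<omega> \<in> Run M s"
    proof -
      have eq: "xs ! i = \<omega> i" if "i < length xs" for i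
        using xs(2) that by (simp add: B_def)
      have ne: "xs \<noteq> []"
        using xs(1) by (simp add: X_def)
      show ?thesis
        using \<open>\<omega> \<in> Run M s\<close> ne by (simp add: finite_path_def Run_def hd_conv_nth eq)
    qed
    with xs show "\<omega> \<in> space L - Run M s"
      by (auto simp: X_def B_def)
  qed
  have w_prod: "(\<Prod>i<length xs. w (nth xs) i)
      = (if hd xs = s then 1 else 0) * (\<Prod>i<length xs - 1. q (xs ! i) (xs ! Suc i))"
    if "xs \<noteq> []" for xs
  proof -
    from that obtain n where n: "length xs = Suc n" by (cases xs) auto
    show ?thesis
      unfolding n prod.lessThan_Suc_shift using that by (simp add: w_def hd_conv_nth)
  qed
  have null: "emeasure L (B xs) = 0" if "xs \<in> X" for xs
  proof -
    have xs: "xs \<in> lists S" "xs \<noteq> []" "\<not> finite_path M s xs"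
      using that by (auto simp: X_def)
    show ?thesis
    proof (cases "hd xs = s")
      case True
      with xs obtain i where i: "Suc i < length xs" "(xs ! i, xs ! Suc i) \<notin> transitions M"
        by (auto simp: finite_path_def)
      then have "q (xs ! i) (xs ! Suc i) = 0" "i < length xs - 1"
        by (auto simp: q_def)
      then show ?thesis
        using B(2)[OF xs(1)] w_prod[OF xs(2)] by (auto intro!: prod_zero)
    qed (use B(2)[OF xs(1)] w_prod[OF xs(2)] in simp)
  qed
  have "space L - Run M s \<in> null_sets L"
    unfolding compl using \<open>countable X\<close> null B(1)
    by (intro null_sets_UN') (auto simp: X_def)
  then have AE: "AE \<omega> in L. \<omega> \<in> Run M s" and Run_sets: "Run M s \<in> sets L"
    using Run_L by (auto simp: AE_iff_null_sets null_sets_def double_diff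
        intro!: AE_I'[of "space L - Run M s"] dest: sets.compl_sets)

  define G where "G = {Cyl M s xs |xs. finite_path M s xs}"
  define \<mu> where "\<mu> = distr (restrict_space L (Run M s)) (sigma (Run M s) G) (\<lambda>\<omega>. \<omega>)"
  have path_S: "xs \<in> lists S" if "finite_path M s xs" for xs
  proof -
    have "xs ! i \<in> S" if "i < length xs" for i
      using that \<open>finite_path M s xs\<close> s E
      by (cases i) (auto simp: finite_path_def hd_conv_nth)
    then show ?thesis by (auto simp: in_lists_conv_set in_set_conv_nth)
  qed
  have Cyl: "Cyl M s xs = B xs \<inter> Run M s" for xs
    using Run_L by (auto simp: Cyl_def B_def)
  have G: "G \<subseteq> Pow (Run M s)"
    by (auto simp: G_def Cyl_def)
  have sets_\<mu>: "sets \<mu> = sigma_sets (Run M s) G" and space_\<mu>: "space \<mu> = Run M s"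
    using G by (simp_all add: \<mu>_def)
  have id: "(\<lambda>\<omega>. \<omega>) \<in> measurable (restrict_space L (Run M s)) (sigma (Run M s) G)"
  proof (rule measurable_measure_of)
    show "(\<lambda>\<omega>. \<omega>) \<in> space (restrict_space L (Run M s)) \<rightarrow> Run M s"
      by (auto simp: space_restrict_space)
    fix A assume "A \<in> G"
    then obtain xs where xs: "finite_path M s xs" "A = B xs \<inter> Run M s"
      by (auto simp: G_def Cyl)
    then show "(\<lambda>\<omega>. \<omega>) -` A \<inter> space (restrict_space L (Run M s)) \<in> sets (restrict_space L (Run M s))"
      using B(1)[OF path_S[OF xs(1)]] Run_L by (auto simp: space_restrict_space sets_restrict_space)
  qed (rule G)
  have em: "emeasure \<mu> A = emeasure L A" if "A \<in> sets \<mu>" for A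
  proof -
    have A: "A \<subseteq> Run M s"
      using sets.sets_into_space[OF that] by (simp add: space_\<mu>)
    have "emeasure \<mu> A = emeasure (restrict_space L (Run M s)) (A \<inter> space (restrict_space L (Run M s)))"
      using that G unfolding \<mu>_def by (subst emeasure_distr[OF id]) auto
    also have "A \<inter> space (restrict_space L (Run M s)) = A"
      using A Run_L by (auto simp: space_restrict_space)
    also have "emeasure (restrict_space L (Run M s)) A = emeasure L A"
      using A Run_sets by (intro emeasure_restrict_space) (auto simp: Int_absorb2 sets.Int)
    finally show ?thesis .
  qed
  have "is_run_measure M s \<mu>"
    unfolding is_run_measure_def
  proof (intro conjI allI impI)
    show "prob_space \<mu>"
    proof (rule prob_spaceI)
      have "emeasure \<mu> (space \<mu>) = emeasure L (Run M s)"
        using em[OF sets.top] by (simp add: space_\<mu>)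
      also have "\<dots> = 1"
        using AE Run_sets by (simp add: L.emeasure_eq_1_AE)
      finally show "emeasure \<mu> (space \<mu>) = 1" .
    qed
    show "space \<mu> = Run M s" by (rule space_\<mu>)
    show "sets \<mu> = sigma_sets (Run M s) {Cyl M s xs |xs. finite_path M s xs}"
      by (simp add: sets_\<mu> G_def)
    fix xs assume xs: "finite_path M s xs"
    have "Cyl M s xs \<in> sets \<mu>"
      using xs unfolding sets_\<mu> G_def by (intro sigma_sets.Basic) blast
    then have "emeasure \<mu> (Cyl M s xs) = emeasure L (B xs \<inter> Run M s)"
      by (simp add: em Cyl)
    also have "\<dots> = emeasure L (B xs)"
      using AE B(1)[OF path_S[OF xs]] Run_sets by (intro emeasure_eq_AE) auto
    also have "\<dots> = (\<Prod>i<length xs - 1. q (xs ! i) (xs ! Suc i))"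
      using B(2)[OF path_S[OF xs]] w_prod[of xs] xs by (simp add: finite_path_def)
    also have "\<dots> = (\<Prod>i<length xs - 1. ennreal (transition_prob M (xs ! i, xs ! Suc i)))"
      using xs by (intro prod.cong) (auto simp: q_def finite_path_def)
    also have "\<dots> = ennreal (\<Prod>i<length xs - 1. transition_prob M (xs ! i, xs ! Suc i))"
      using xs M by (intro prod_ennreal)
        (auto simp: finite_path_def is_markov_chain_def less_imp_le)
    finally show "emeasure \<mu> (Cyl M s xs)
      = ennreal (\<Prod>i<length xs - 1. transition_prob M (xs ! i, xs ! Suc i))" .
  qed
  then show ?thesis ..
qed

lemma run_measure_unique:
  assumes "is_run_measure M s \<mu>" "is_run_measure M s \<mu>'"
  shows "\<mu> = \<mu>'"
proof -
  define G where "G = insert {} {Cyl M s xs |xs. finite_path M s xs}"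
  have Pow: "G \<subseteq> Pow (Run M s)" and Pow': "{Cyl M s xs |xs. finite_path M s xs} \<subseteq> Pow (Run M s)"
    by (auto simp: G_def Cyl_def)
  have sets: "sigma_sets (Run M s) {Cyl M s xs |xs. finite_path M s xs} = sigma_sets (Run M s) G"
    unfolding G_def
    by (rule sigma_sets_eqI) (blast intro: sigma_sets.Basic sigma_sets.Empty)+
  have stable: "Int_stable G"
  proof (rule Int_stableI)
    have *: "Cyl M s xs \<inter> Cyl M s ys \<in> G"
      if "finite_path M s xs" "finite_path M s ys" "length xs \<le> length ys" for xs ys
    proof (cases "\<forall>i<length xs. xs ! i = ys ! i")
      case True
      with that(3) have "Cyl M s xs \<inter> Cyl M s ys = Cyl M s ys"
        by (auto simp: Cyl_def)
      with that(2) show ?thesis by (auto simp: G_def)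
    next
      case False
      then have "Cyl M s xs \<inter> Cyl M s ys = {}"
        using that(3) by (auto simp: Cyl_def)
      then show ?thesis by (simp add: G_def)
    qed
    fix a b assume "a \<in> G" "b \<in> G"
    then consider "a = {} \<or> b = {}"
      | xs ys where "finite_path M s xs" "finite_path M s ys" "a = Cyl M s xs" "b = Cyl M s ys"
      by (auto simp: G_def)
    then show "a \<inter> b \<in> G"
    proof cases
      case 1
      then show ?thesis by (auto simp: G_def)
    next
      case 2
      then show ?thesis
        using *[of xs ys] *[of ys xs] by (cases "length xs \<le> length ys") (auto simp: Int_commute)
    qed
  qed
  have Run: "Cyl M s [s] = Run M s" "finite_path M s [s]"
    by (auto simp: Cyl_def Run_def finite_path_def)
  show ?thesis
  proof (rule measure_eqI_generator_eq[OF stable Pow, where A = "\<lambda>_. Run M s"])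
    show "sets \<mu> = sigma_sets (Run M s) G" "sets \<mu>' = sigma_sets (Run M s) G"
      using assms by (simp_all add: is_run_measure_def sets)
    show "emeasure \<mu> X = emeasure \<mu>' X" if "X \<in> G" for X
      using that assms by (auto simp: G_def is_run_measure_def)
    show "range (\<lambda>_. Run M s) \<subseteq> G"
      using Run by (force simp: G_def)
    show "emeasure \<mu> (Run M s) \<noteq> \<infinity>"
      using assms(1) prob_space.emeasure_space_1[of \<mu>] by (auto simp: is_run_measure_def)
  qed simp
qed

theorem ex1_run_measure:
  assumes "is_markov_chain M" "s \<in> states M"
  shows "\<exists>!\<mu>. is_run_measure M s \<mu>"
  using ex_run_measure[OF assms] run_measure_unique by (rule ex_ex1I)

corollary is_run_measure_run_measure:
  assumes "is_markov_chain M" "s \<in> states M"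
  shows "is_run_measure M s (run_measure M s)"
  unfolding run_measure_def by (rule theI'[OF ex1_run_measure[OF assms]])

lemma measurable_run_component:
  assumes "is_markov_chain M" "s \<in> states M"
  shows "{\<pi> \<in> Run M s. \<pi> i \<in> A} \<in> sets (run_measure M s)"
proof -
  let ?R = "run_measure M s"
  define X where "X = {xs \<in> lists (states M). finite_path M s xs \<and> length xs = Suc i \<and> xs ! i \<in> A}"
  have "countable X"
    using assms by (auto simp: X_def is_markov_chain_def intro: countable_subset[of _ "lists (states M)"])
  moreover have "Cyl M s xs \<in> sets ?R" if "xs \<in> X" for xs
    using is_run_measure_run_measure[OF assms] that
    unfolding is_run_measure_def X_def by (auto intro!: sigma_sets.Basic)
  ultimately have "(\<Union>xs\<in>X. Cyl M s xs) \<in> sets ?R"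
    by (intro sets.countable_UN') auto
  also have "(\<Union>xs\<in>X. Cyl M s xs) = {\<pi> \<in> Run M s. \<pi> i \<in> A}"
  proof (intro equalityI subsetI)
    fix \<pi> assume \<pi>: "\<pi> \<in> {\<pi> \<in> Run M s. \<pi> i \<in> A}"
    have "\<pi> j \<in> states M" for j
      using \<pi> assms by (auto simp: Run_def is_markov_chain_def)
    with \<pi> have "map \<pi> [0..<Suc i] \<in> X" "\<pi> \<in> Cyl M s (map \<pi> [0..<Suc i])"
      by (auto simp: X_def finite_path_def Run_def Cyl_def hd_map simp del: upt_Suc)
    then show "\<pi> \<in> (\<Union>xs\<in>X. Cyl M s xs)" by blast
  qed (auto simp: X_def Cyl_def)
  finally show ?thesis .
qed

lemma measurable_path_sat:
  assumes "is_markov_chain M" "s \<in> states M"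
  shows "{\<pi> \<in> Run M s. path_sat M \<nu> \<phi> \<pi>} \<in> sets (run_measure M s)"
proof -
  note comp = measurable_run_component[OF assms]
  have sp: "space (run_measure M s) = Run M s"
    using is_run_measure_run_measure[OF assms] by (simp add: is_run_measure_def)
  show ?thesis
  proof (cases \<phi>)
    case (Next \<Phi>)
    then show ?thesis using comp[of 1 "{s. sat M \<nu> \<Phi> s}"] by simp
  next
    case (Until \<Phi>\<^sub>1 \<Phi>\<^sub>2)
    have "{\<pi> \<in> space (run_measure M s). \<exists>k. sat M \<nu> \<Phi>\<^sub>2 (\<pi> k) \<and> (\<forall>j\<in>{..<k}. sat M \<nu> \<Phi>\<^sub>1 (\<pi> j))}
        \<in> sets (run_measure M s)"
      using comp[of _ "{s. sat M \<nu> \<Phi>\<^sub>2 s}"] comp[of _ "{s. sat M \<nu> \<Phi>\<^sub>1 s}"]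
      by (intro sets.sets_Collect_countable_Ex sets.sets_Collect_conj sets.sets_Collect_finite_All)
         (auto simp: sp)
    then show ?thesis by (simp add: Until sp Ball_def)
  qed
qed

end

theory Submission
  imports Defs "HOL-Number_Theory.Cong"
begin

text \<open>First-order arithmetic is interpreted in PCTL over one pBPA, with the values of the variables stored
  in unary on the stack. While the control symbol is on top, letters are pushed, and \<open>\<P>\<^bsub>>0\<^esub>\<close> of an until formula
  that restricts the heads is an existential quantifier over the pushed word. Once popping starts, an until
  formula composes affine maps \<open>y \<mapsto> (p + q y) / 6\<close>, one for each letter, and different formulas see different
  maps on the same stack. Two such values are tested for equality by guessing a word of certificate digits
  that sends both of them to the same one of the constants 0, 1/2, 1. Equality of values expresses equality of
  counters, and, applied to the digits of \<open>(2\<^bsup>xk\<^esup> - 1) / (2\<^sup>x - 1)\<close>, it expresses multiplication.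

  By Goedel's beta function the graph of every recursive function is definable in arithmetic. Given a decider,
  the sentence saying that it rejects the encoded instance whose codes are on the stack yields a pBPA and
  a formula; starting with their own codes on the stack, the decider is wrong.\<close>

section \<open>Arithmetical definability of recursive functions\<close>

text \<open>The number 6 serves two kinds of maps. Slope 3/6 halves a value, which codes counters in
  exponents and binary words in fractions; such values are dyadic. Slope 4/6 = 2/3 belongs to the
  certificate digits: it lowers the power of 2 in the denominator when the factor 3 cancels, and the
  offsets 0, 1, 2 reach every residue modulo 3. The largest digit takes 2 + 4 outcomes, exactly six.
  Counters in exponents can be added but not multiplied. A product is read off a periodic word: if
  every block of x digits has a single 1, there are x times as many digits as ones. For given x and
  length, periodicity is one linear equation in the value of the word, and two tracks evaluate its
  sides. A state formula is evaluated where it stands, so letters guessed inside it are gone for its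
  neighbours, and negation and conjunction can be used freely. Self-reference goes through the
  stack: the sentence depends on the decider alone and reads the codes as parameters, so system,
  assignment and formula are fixed before their codes are taken. Only the code of the initial
  configuration has to be computed.\<close>

text \<open>A formula at depth \<open>d\<close> binds the variable \<open>d\<close>. The atom is \<open>(e i + 1) e j + e k = e l\<close>: its factor
  \<open>e i + 1\<close> is never 0, as needed for the gadget that checks it, and it still defines zero, addition and
  multiplication.\<close>

datatype fm = FAtom nat nat nat nat | FNot fm | FAnd fm fm | FEx fm

primrec holds :: "fm \<Rightarrow> nat \<Rightarrow> (nat \<Rightarrow> nat) \<Rightarrow> bool" where
  "holds (FAtom i j k l) d e \<longleftrightarrow> Suc (e i) * e j + e k = e l"
| "holds (FNot \<phi>) d e \<longleftrightarrow> \<not> holds \<phi> d e"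
| "holds (FAnd \<phi> \<psi>) d e \<longleftrightarrow> holds \<phi> d e \<and> holds \<psi> d e"
| "holds (FEx \<phi>) d e \<longleftrightarrow> (\<exists>n. holds \<phi> (Suc d) (e(d := n)))"

text \<open>Definability is stated for relations on environments, so formulas are composed without
  substitution; compound terms are expressed by quantified variables.\<close>

definition arith :: "nat \<Rightarrow> ((nat \<Rightarrow> nat) \<Rightarrow> bool) \<Rightarrow> bool" where
  "arith d R \<longleftrightarrow> (\<exists>\<phi>. \<forall>e. holds \<phi> d e \<longleftrightarrow> R e)"

lemma arith_atom: "arith d (\<lambda>e. Suc (e i) * e j + e k = e l)"
  unfolding arith_def by (intro exI[of _ "FAtom i j k l"]) simp

lemma arith_not:
  assumes "arith d R"
  shows "arith d (\<lambda>e. \<not> R e)"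
proof -
  from assms obtain \<phi> where "\<forall>e. holds \<phi> d e \<longleftrightarrow> R e"
    unfolding arith_def ..
  then show ?thesis
    unfolding arith_def by (intro exI[of _ "FNot \<phi>"]) simp
qed

lemma arith_conj:
  assumes "arith d R" "arith d S"
  shows "arith d (\<lambda>e. R e \<and> S e)"
proof -
  from assms obtain \<phi> \<psi> where "\<forall>e. holds \<phi> d e \<longleftrightarrow> R e" "\<forall>e. holds \<psi> d e \<longleftrightarrow> S e"
    unfolding arith_def by blast
  then show ?thesis
    unfolding arith_def by (intro exI[of _ "FAnd \<phi> \<psi>"]) simp
qed

lemma arith_imp:
  assumes "arith d R" "arith d S"
  shows "arith d (\<lambda>e. R e \<longrightarrow> S e)"
  using arith_not[OF arith_conj[OF assms(1) arith_not[OF assms(2)]]] by simp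

text \<open>\<open>R\<close> reads from variable \<open>d\<close> the value that \<open>Q\<close>
  calls \<open>n\<close>. The second premise holds when the other variables involved lie below
  \<open>d\<close>, whence bounds such as \<open>i < d\<close> in the rules that follow.\<close>

lemma arith_ex:
  assumes "arith (Suc d) R" "\<And>e n. R (e(d := n)) \<longleftrightarrow> Q e n"
  shows "arith d (\<lambda>e. \<exists>n. Q e n)"
proof -
  from assms(1) obtain \<phi> where "\<And>e. holds \<phi> (Suc d) e \<longleftrightarrow> R e"
    unfolding arith_def by blast
  then show ?thesis
    unfolding arith_def using assms(2) by (intro exI[of _ "FEx \<phi>"]) simp
qed

lemma arith_all:
  assumes "arith (Suc d) R" "\<And>e n. R (e(d := n)) \<longleftrightarrow> Q e n"
  shows "arith d (\<lambda>e. \<forall>n. Q e n)"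
  using arith_not[OF arith_ex[OF arith_not[OF assms(1)], of "\<lambda>e n. \<not> Q e n"]] assms(2) by simp

text \<open>With all four indices equal the atom reads (x + 1) x + x = x, which forces x =
  0.\<close>

lemma arith_zero: "arith d (\<lambda>e. e i = 0)"
  using arith_atom[of d i i i i] by simp

lemma arith_False: "arith d (\<lambda>e. False)"
  by (rule back_subst[of "arith d", OF arith_conj[OF arith_zero[of d 0] arith_not[OF arith_zero[of d 0]]]])
     auto

lemma arith_add:
  assumes "i < d" "j < d" "k < d"
  shows "arith d (\<lambda>e. e i + e j = e k)"
proof -
  have "arith d (\<lambda>e. \<exists>z. z = 0 \<and> Suc z * e i + e j = e k)"
    by (rule arith_ex[OF arith_conj[OF arith_zero[of _ d] arith_atom[of _ d i j k]]])
       (use assms in simp)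
  then show ?thesis by simp
qed

lemma arith_eq:
  assumes "i < d" "j < d"
  shows "arith d (\<lambda>e. e i = e j)"
proof -
  have "arith d (\<lambda>e. \<exists>z. z = 0 \<and> Suc z * e i + z = e j)"
    by (rule arith_ex[OF arith_conj[OF arith_zero[of _ d] arith_atom[of _ d i d j]]])
       (use assms in simp)
  then show ?thesis by simp
qed

lemma arith_one: "i < d \<Longrightarrow> arith d (\<lambda>e. e i = 1)"
proof -
  assume "i < d"
  \<comment> \<open>The equation (x + 1) x = x + x has the solutions 0 and 1 only.\<close>
  have "arith d (\<lambda>e. \<exists>z. (z = 0 \<and> Suc z * z + z = z) \<and> \<not> e i = 0 \<and> (\<exists>m. Suc (e i) * e i + z = m \<and> e i + e i = m))"
  proof (rule arith_ex[OF arith_conj[OF arith_conj[OF arith_zero[of _ d] arith_atom[of _ d d d d]]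
          arith_conj[OF arith_not[OF arith_zero[of _ i]] arith_ex[OF arith_conj[OF
          arith_atom[of _ i i d "Suc d"] arith_add[of i _ i "Suc d"]]]]]])
  qed (use \<open>i < d\<close> in auto)
  then show ?thesis
    by (rule back_subst[of "arith d"]) auto
qed

lemma arith_Suc:
  assumes "i < d" "j < d"
  shows "arith d (\<lambda>e. e j = Suc (e i))"
proof -
  have "arith d (\<lambda>e. \<exists>z. z = 1 \<and> z + e i = e j)"
    by (rule arith_ex[OF arith_conj[OF arith_one[of d] arith_add[of d _ i j]]])
       (use assms in simp_all)
  then show ?thesis by (simp add: eq_commute)
qed

lemma arith_le:
  assumes "i < d" "j < d"
  shows "arith d (\<lambda>e. e i \<le> e j)"
proof -
  have "arith d (\<lambda>e. \<exists>r. e i + r = e j)"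
    by (rule arith_ex[OF arith_add[of i _ d j]]) (use assms in simp_all)
  then show ?thesis by (simp add: le_iff_add eq_commute)
qed

lemma arith_less:
  assumes "i < d" "j < d"
  shows "arith d (\<lambda>e. e i < e j)"
  using arith_not[OF arith_le[OF assms(2,1)]] by (simp add: not_le)

section \<open>Goedel's beta function\<close>

definition beta :: "nat \<Rightarrow> nat \<Rightarrow> nat \<Rightarrow> nat" where
  "beta c b m = c mod Suc (Suc m * b)"

text \<open>The modulus is \<open>Suc X\<close> with \<open>X = Suc m * b\<close>, so both the
  product and the division with remainder have the successor factor of the atom.\<close>

lemma beta_eq_iff: "beta c b m = v \<longleftrightarrow> (\<exists>X. (\<exists>z. z = 0 \<and> Suc m * b + z = X) \<and> v \<le> X \<and> (\<exists>q. Suc X * q + v = c))"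
proof -
  have "beta c b m = v \<longleftrightarrow> v \<le> Suc m * b \<and> (\<exists>q. Suc (Suc m * b) * q + v = c)"
  proof
    assume v: "beta c b m = v"
    then have "v < Suc (Suc m * b)"
      unfolding beta_def by (metis mod_less_divisor zero_less_Suc)
    moreover have "Suc (Suc m * b) * (c div Suc (Suc m * b)) + v = c"
      using mult_div_mod_eq[of "Suc (Suc m * b)" c] v unfolding beta_def by simp
    ultimately show "v \<le> Suc m * b \<and> (\<exists>q. Suc (Suc m * b) * q + v = c)"
      by (metis less_Suc_eq_le)
  next
    assume "v \<le> Suc m * b \<and> (\<exists>q. Suc (Suc m * b) * q + v = c)"
    then obtain q where "v < Suc (Suc m * b)" "c = Suc (Suc m * b) * q + v"
      by (metis less_Suc_eq_le)
    then show "beta c b m = v"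
      unfolding beta_def by (metis mod_less mod_mult_self4)
  qed
  then show ?thesis by auto
qed

lemma arith_beta:
  assumes "c < d" "b < d" "m < d" "v < d"
  shows "arith d (\<lambda>e. beta (e c) (e b) (e m) = e v)"
proof -
  note ac = arith_conj[OF arith_zero[of _ "Suc d"] arith_atom[of _ m b "Suc d" d]]
  have X: "arith (Suc d) (\<lambda>e. \<exists>z. z = 0 \<and> Suc (e m) * e b + z = e d)"
    by (rule arith_ex[OF ac]) (use assms in auto)
  have q: "arith (Suc d) (\<lambda>e. \<exists>q. Suc (e d) * q + e v = e c)"
    by (rule arith_ex[OF arith_atom[of _ d "Suc d" v c]]) (use assms in auto)
  have le: "arith (Suc d) (\<lambda>e. e v \<le> e d)"
    using assms by (intro arith_le) auto
  show ?thesis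
    unfolding beta_eq_iff by (rule arith_ex[OF arith_conj[OF X arith_conj[OF le q]]]) (use assms in auto)
qed

text \<open>Take b = N! for a bound N of \<open>n\<close> and of the values. A prime dividing two
  moduli divides (j - i) b, hence b, hence 1, so the Chinese remainder theorem gives c; the values
  are at most b and therefore remainders.\<close>

lemma beta_surj: "\<exists>c b. \<forall>m\<le>n. beta c b m = s m"
proof -
  define N where "N = Max (insert n (s ` {..n}))"
  have N: "n \<le> N" "\<And>m. m \<le> n \<Longrightarrow> s m \<le> N"
    unfolding N_def by (rule Max_ge; simp)+
  define b :: nat where "b = fact N"
  let ?M = "\<lambda>m. Suc (Suc m * b)"
  have copr: "coprime (?M i) (?M j)" if "i < j" "j \<le> n" for i j
  proof (rule ccontr)
    assume "\<not> coprime (?M i) (?M j)"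
    then have "gcd (?M i) (?M j) \<noteq> 1"
      by (simp add: coprime_iff_gcd_eq_1)
    then obtain p where p: "prime p" "p dvd gcd (?M i) (?M j)"
      using prime_factor_nat by blast
    then have pi: "p dvd ?M i" and pj: "p dvd ?M j"
      by auto
    have "?M j - ?M i = (j - i) * b"
      by (simp add: diff_mult_distrib)
    with dvd_diff_nat[OF pj pi] have "p dvd (j - i) * b"
      by simp
    then have "p dvd (j - i) \<or> p dvd b"
      using p(1) by (simp add: prime_dvd_mult_iff)
    then have "p dvd b"
    proof
      assume "p dvd j - i"
      then have "p \<le> N"
        using that N(1) by (meson dvd_imp_le diff_le_self le_trans zero_less_diff)
      then show ?thesis
        using p(1) unfolding b_def by (simp add: prime_dvd_fact_iff)
    qed
    then have "p dvd 1"
      using pi by (metis Suc_eq_plus1 dvd_add_right_iff dvd_mult)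
    then show False
      using p(1) by simp
  qed
  have "\<forall>i\<in>{..n}. \<forall>j\<in>{..n}. i \<noteq> j \<longrightarrow> coprime (?M i) (?M j)"
  proof (intro ballI impI)
    fix i j assume "i \<in> {..n}" "j \<in> {..n}" "i \<noteq> j"
    then show "coprime (?M i) (?M j)"
      using copr[of i j] copr[of j i] by (cases "i < j") (auto simp: coprime_commute)
  qed
  from chinese_remainder_nat[OF finite_atMost this]
  obtain c where c: "\<forall>m\<in>{..n}. [c = s m] (mod ?M m)"
    by blast
  have "beta c b m = s m" if "m \<le> n" for m
  proof -
    have "s m \<le> Suc m * b"
      using N(2)[OF that] fact_ge_self[of N] by (auto simp: b_def intro: le_trans trans_le_add1)
    then show ?thesis
      using c that by (simp add: beta_def cong_def)
  qed
  then show ?thesis by blast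
qed

section \<open>Graphs of recursive functions are arithmetical\<close>

lemma computes_PrimRec_iff:
  "computes (PrimRec f g) (n # xs) y \<longleftrightarrow>
     (\<exists>s. computes f xs (s 0) \<and> s n = y \<and> (\<forall>m<n. computes g (m # s m # xs) (s (Suc m))))"
proof
  show "computes (PrimRec f g) (n # xs) y \<Longrightarrow>
     \<exists>s. computes f xs (s 0) \<and> s n = y \<and> (\<forall>m<n. computes g (m # s m # xs) (s (Suc m)))"
  proof (induction n arbitrary: y)
    case 0
    then show ?case by (auto elim!: computes_PrimRec_0E intro: exI[of _ "\<lambda>_. y"])
  next
    case (Suc n)
    from Suc.prems obtain y' where y': "computes (PrimRec f g) (n # xs) y'" "computes g (n # y' # xs) y"
      by (rule computes_PrimRec_SucE)
    from Suc.IH[OF y'(1)] obtain s where s: "computes f xs (s 0)" "s n = y'"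
      "\<forall>m<n. computes g (m # s m # xs) (s (Suc m))"
      by blast
    then show ?case
      using y'(2) by (intro exI[of _ "s(Suc n := y)"]) (auto simp: less_Suc_eq)
  qed
next
  assume "\<exists>s. computes f xs (s 0) \<and> s n = y \<and> (\<forall>m<n. computes g (m # s m # xs) (s (Suc m)))"
  then obtain s where s: "computes f xs (s 0)" "s n = y" "\<forall>m<n. computes g (m # s m # xs) (s (Suc m))"
    by blast
  have "m \<le> n \<Longrightarrow> computes (PrimRec f g) (m # xs) (s m)" for m
    by (induction m) (use s in \<open>auto intro: computes.intros\<close>)
  then show "computes (PrimRec f g) (n # xs) y"
    using s(2) by blast
qed

inductive_cases computes_PrimRecE: "computes (PrimRec f g) xs z"

text \<open>Two numbers code the sequence of intermediate values. Zero and \<open>Suc m\<close> get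
  quantifiers of their own because \<open>arith_beta\<close> takes its arguments from
  variables.\<close>

lemma computes_PrimRec_beta:
  "computes (PrimRec f g) (n # xs) y \<longleftrightarrow>
     (\<exists>c b. (\<exists>v. (\<exists>z. z = 0 \<and> beta c b z = v) \<and> computes f xs v) \<and> beta c b n = y \<and>
        (\<forall>m. m < n \<longrightarrow> (\<exists>v. beta c b m = v \<and> (\<exists>v'. (\<exists>m'. m' = Suc m \<and> beta c b m' = v') \<and>
           computes g (m # v # xs) v'))))"
  (is "?L \<longleftrightarrow> ?R")
proof
  assume ?L
  then obtain s where s: "computes f xs (s 0)" "s n = y" "\<forall>m<n. computes g (m # s m # xs) (s (Suc m))"
    unfolding computes_PrimRec_iff by blast
  obtain c b where "\<forall>m\<le>n. beta c b m = s m"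
    using beta_surj by blast
  with s show ?R
    by (intro exI[of _ c] exI[of _ b]) (simp add: less_eq_Suc_le)
next
  assume ?R
  then show ?L
    unfolding computes_PrimRec_iff by (auto intro: exI[of _ "beta c b" for c b])
qed

lemma computes_Mu_iff:
  "computes (Mu f) xs n \<longleftrightarrow> (\<exists>z. z = 0 \<and> computes f (n # xs) z) \<and>
     (\<forall>m. m < n \<longrightarrow> (\<exists>k. \<not> k = 0 \<and> computes f (m # xs) k))"
  (is "?L \<longleftrightarrow> ?R")
proof
  assume ?L
  then show ?R
    by (rule computes_MuE) (metis nat.distinct(1))
next
  assume ?R
  then show ?L
    by (intro computes.mu) (metis not0_implies_Suc)+
qed

text \<open>Arguments and value are indices of variables, so that a subcomputation can be applied to
  freshly bound ones. A wrong number of arguments yields the false relation.\<close>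

lemma arith_computes:
  assumes "set is \<subseteq> {..<d}" "r < d"
  shows "arith d (\<lambda>e. computes f (map e is) (e r))"
  using assms
proof (induction f arbitrary: d "is" r)
  case Zero
  have "computes Zero (map e is) (e r) \<longleftrightarrow> e r = 0" for e
    by (auto elim: computes_ZeroE intro: computes.zero)
  then show ?case by (simp add: arith_zero)
next
  case Succ
  show ?case
  proof (cases "\<exists>i. is = [i]")
    case True
    then obtain i where "is = [i]" ..
    then have "computes Succ (map e is) (e r) \<longleftrightarrow> e r = Suc (e i)" for e
      by (auto elim: computes_SuccE intro: computes.succ)
    with Succ \<open>is = [i]\<close> show ?thesis by (simp add: arith_Suc)
  next
    case False
    then have "\<not> computes Succ (map e is) (e r)" for e
      by (auto elim!: computes_SuccE)
    then show ?thesis by (simp add: arith_False)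
  qed
next
  case (Proj i)
  show ?case
  proof (cases "i < length is")
    case True
    then have "computes (Proj i) (map e is) (e r) \<longleftrightarrow> e r = e (is ! i)" for e
      by (metis True computes.proj computes_ProjE length_map nth_map)
    moreover have "is ! i < d"
      using True Proj by (meson lessThan_iff nth_mem subsetD)
    ultimately show ?thesis using Proj by (simp add: arith_eq)
  next
    case False
    then have "\<not> computes (Proj i) (map e is) (e r)" for e
      by (auto elim!: computes_ProjE)
    then show ?thesis by (simp add: arith_False)
  qed
next
  case (Comp f gs)
  have iff: "computes (Comp f gs) xs z \<longleftrightarrow>
      (\<exists>ys. list_all2 (\<lambda>g y. computes g xs y) gs ys \<and> computes f ys z)" for xs z
    by (auto elim: computes_CompE intro: computes.comp)
  \<comment> \<open>The inner functions are treated one at a time: \<open>js\<close> holds the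
    variables of the results already obtained, \<open>hs\<close> the functions still to
    come.\<close>
  have *: "arith d (\<lambda>e. \<exists>ys. list_all2 (\<lambda>g y. computes g (map e is) y) hs ys \<and>
      computes f (map e js @ ys) (e r))"
    if "set hs \<subseteq> set gs" "set js \<subseteq> {..<d}" "set is \<subseteq> {..<d}" "r < d" for d hs js
    using that
  proof (induction hs arbitrary: d js)
    case Nil
    then show ?case using Comp.IH(1)[of js d r] by simp
  next
    case (Cons h hs)
    have "arith d (\<lambda>e. \<exists>y. computes h (map e is) y \<and> (\<exists>ys. list_all2 (\<lambda>g y. computes g (map e is) y) hs ys \<and>
      computes f (map e js @ y # ys) (e r)))"
    proof (rule arith_ex)
      show "arith (Suc d) (\<lambda>e. computes h (map e is) (e d) \<and> (\<exists>ys. list_all2 (\<lambda>g y. computes g (map e is) y) hs ys \<and>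
        computes f (map e (js @ [d]) @ ys) (e r)))"
        using Cons.prems by (intro arith_conj Comp.IH(2) Cons.IH) (auto simp: less_Suc_eq)
      have [simp]: "map (e(d := n)) is = map e is" "map (e(d := n)) js = map e js" for e :: "nat \<Rightarrow> nat" and n
        using Cons.prems by (auto intro!: map_fun_upd)
      then show "(computes h (map (e(d := n)) is) ((e(d := n)) d) \<and>
         (\<exists>ys. list_all2 (\<lambda>g. computes g (map (e(d := n)) is)) hs ys \<and>
           computes f (map (e(d := n)) (js @ [d]) @ ys) ((e(d := n)) r))) =
        (computes h (map e is) n \<and> (\<exists>ys. list_all2 (\<lambda>g. computes g (map e is)) hs ys \<and>
           computes f (map e js @ n # ys) (e r)))" for e n
        using Cons.prems by (simp del: map_fun_upd fun_upd_apply add: fun_upd_same fun_upd_other)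
    qed
    moreover have "(\<exists>ys. list_all2 P (h # hs) ys \<and> Q ys) \<longleftrightarrow> (\<exists>y. P h y \<and> (\<exists>ys. list_all2 P hs ys \<and> Q (y # ys)))"
      for P :: "recf \<Rightarrow> nat \<Rightarrow> bool" and Q
      by (auto simp: list_all2_Cons1)
    ultimately show ?case by simp
  qed
  from *[of gs "[]" d] Comp.prems show ?case
    by (simp add: iff)
next
  case (PrimRec f g)
  show ?case
  proof (cases "is")
    case Nil
    then have "\<not> computes (PrimRec f g) (map e is) (e r)" for e
      by (auto elim: computes_PrimRecE)
    then show ?thesis by (simp add: arith_False)
  next
    case (Cons i js)
    have j: "map (e(x := n)) js = map e js" if "d \<le> x" for e :: "nat \<Rightarrow> nat" and n x
      using PrimRec.prems Cons that by (intro map_fun_upd) auto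
    have s: "set js \<subseteq> {..<d'}" "i < d'" "r < d'" if "d \<le> d'" for d'
      using PrimRec.prems Cons that by auto
    have ij: "i < d" "r < d"
      using s[of d] by auto
    let ?\<beta> = "\<lambda>e. beta (e d) (e (Suc d))" and ?a = "Suc (Suc d)" and ?b = "Suc (Suc (Suc (Suc d)))"
    have "arith (Suc ?a) (\<lambda>e. \<exists>z. z = 0 \<and> ?\<beta> e z = e ?a)"
      by (rule arith_ex[OF arith_conj[OF arith_zero[of _ "Suc ?a"] arith_beta[of d _ "Suc d" "Suc ?a" ?a]]]) auto
    moreover have "arith (Suc ?a) (\<lambda>e. computes f (map e js) (e ?a))"
      using s[of "Suc ?a"] by (intro PrimRec.IH(1)) auto
    ultimately have 0: "arith ?a (\<lambda>e. \<exists>v. (\<exists>z. z = 0 \<and> ?\<beta> e z = v) \<and> computes f (map e js) v)"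
      by (rule arith_ex[OF arith_conj]) (simp add: j)
    have n: "arith ?a (\<lambda>e. ?\<beta> e (e i) = e r)"
      using ij by (intro arith_beta) auto
    have "arith (Suc ?b) (\<lambda>e. \<exists>m'. m' = Suc (e ?a) \<and> ?\<beta> e m' = e ?b)"
      by (rule arith_ex[OF arith_conj[OF arith_Suc[of ?a _ "Suc ?b"] arith_beta[of d _ "Suc d" "Suc ?b" ?b]]]) auto
    moreover have "arith (Suc ?b) (\<lambda>e. computes g (map e (?a # Suc ?a # js)) (e ?b))"
      using s[of "Suc ?b"] by (intro PrimRec.IH(2)) auto
    ultimately have v': "arith ?b (\<lambda>e. \<exists>v'. (\<exists>m'. m' = Suc (e ?a) \<and> ?\<beta> e m' = v') \<and>
        computes g (e ?a # e (Suc ?a) # map e js) v')"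
      by (rule arith_ex[OF arith_conj]) (simp add: j)
    have v: "arith ?b (\<lambda>e. ?\<beta> e (e ?a) = e (Suc ?a))"
      by (rule arith_beta) auto
    have ex: "arith (Suc ?a) (\<lambda>e. \<exists>v. ?\<beta> e (e ?a) = v \<and> (\<exists>v'. (\<exists>m'. m' = Suc (e ?a) \<and> ?\<beta> e m' = v') \<and>
        computes g (e ?a # v # map e js) v'))"
      by (rule arith_ex[OF arith_conj[OF v v']]) (simp add: j)
    have less: "arith (Suc ?a) (\<lambda>e. e ?a < e i)"
      using ij by (intro arith_less) auto
    have step: "arith ?a (\<lambda>e. \<forall>m. m < e i \<longrightarrow> (\<exists>v. ?\<beta> e m = v \<and> (\<exists>v'. (\<exists>m'. m' = Suc m \<and> ?\<beta> e m' = v') \<and>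
        computes g (m # v # map e js) v')))"
      by (rule arith_all[OF arith_imp[OF less ex]]) (use ij in \<open>simp add: j\<close>)
    have "arith (Suc d) (\<lambda>e. \<exists>b. (\<exists>v. (\<exists>z. z = 0 \<and> beta (e d) b z = v) \<and> computes f (map e js) v) \<and>
        beta (e d) b (e i) = e r \<and>
        (\<forall>m. m < e i \<longrightarrow> (\<exists>v. beta (e d) b m = v \<and> (\<exists>v'. (\<exists>m'. m' = Suc m \<and> beta (e d) b m' = v') \<and>
           computes g (m # v # map e js) v'))))"
      by (rule arith_ex[OF arith_conj[OF 0 arith_conj[OF n step]]]) (use ij in \<open>simp add: j\<close>)
    then have "arith d (\<lambda>e. computes (PrimRec f g) (e i # map e js) (e r))"
      unfolding computes_PrimRec_beta by (rule arith_ex) (use ij in \<open>simp add: j\<close>)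
    then show ?thesis
      by (simp add: Cons)
  qed
next
  case (Mu f)
  have j: "map (e(x := n)) is = map e is" if "d \<le> x" for e :: "nat \<Rightarrow> nat" and n x
    using Mu.prems that by (intro map_fun_upd) auto
  have s: "set is \<subseteq> {..<d'}" "r < d'" if "d \<le> d'" for d'
    using Mu.prems that by auto
  have f: "arith (Suc d) (\<lambda>e. computes f (map e (r # is)) (e d))"
    using s[of "Suc d"] by (intro Mu.IH) auto
  have 0: "arith d (\<lambda>e. \<exists>z. z = 0 \<and> computes f (e r # map e is) z)"
    by (rule arith_ex[OF arith_conj[OF arith_zero[of _ d] f]]) (use s(2)[of d] in \<open>simp add: j\<close>)
  have f': "arith (Suc (Suc d)) (\<lambda>e. computes f (map e (d # is)) (e (Suc d)))"
    using s[of "Suc (Suc d)"] by (intro Mu.IH) auto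
  have ex: "arith (Suc d) (\<lambda>e. \<exists>k. \<not> k = 0 \<and> computes f (e d # map e is) k)"
    by (rule arith_ex[OF arith_conj[OF arith_not[OF arith_zero[of _ "Suc d"]] f']]) (simp add: j)
  have less: "arith (Suc d) (\<lambda>e. e d < e r)"
    using s[of "Suc d"] by (intro arith_less) auto
  have "arith d (\<lambda>e. \<forall>m. m < e r \<longrightarrow> (\<exists>k. \<not> k = 0 \<and> computes f (m # map e is) k))"
    by (rule arith_all[OF arith_imp[OF less ex]]) (use s(2)[of d] in \<open>simp add: j\<close>)
  with 0 show ?case
    unfolding computes_Mu_iff by (rule arith_conj)
qed

section \<open>Until probabilities in finitely branching chains\<close>

lemma finite_path_Cons:
  "finite_path M s (x # ys) \<longleftrightarrow> x = s \<and> (ys = [] \<or> (s, hd ys) \<in> transitions M \<and> finite_path M (hd ys) ys)"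
proof (cases ys)
  case (Cons y zs)
  have all: "(\<forall>i. P i) \<longleftrightarrow> P 0 \<and> (\<forall>i. P (Suc i))" for P :: "nat \<Rightarrow> bool"
    by (metis not0_implies_Suc)
  show ?thesis
    unfolding finite_path_def Cons by (subst all) auto
qed (auto simp: finite_path_def)

lemma finite_path_Nil: "\<not> finite_path M s []"
  by (simp add: finite_path_def)

locale finitely_branching =
  fixes M :: "'s markov_chain"
  assumes chain: "is_markov_chain M"
    and finite_succ: "s \<in> states M \<Longrightarrow> finite {t. (s, t) \<in> transitions M}"
begin

lemma transitions_states: "(s, t) \<in> transitions M \<Longrightarrow> s \<in> states M \<and> t \<in> states M"
  using chain by (auto simp: is_markov_chain_def)

lemma transition_prob_pos: "e \<in> transitions M \<Longrightarrow> 0 < transition_prob M e"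
  using chain by (auto simp: is_markov_chain_def)

lemma run_measure:
  assumes "s \<in> states M"
  shows "prob_space (run_measure M s)" "space (run_measure M s) = Run M s"
    "sets (run_measure M s) = sigma_sets (Run M s) {Cyl M s xs |xs. finite_path M s xs}"
    "finite_path M s xs \<Longrightarrow> emeasure (run_measure M s) (Cyl M s xs)
       = ennreal (\<Prod>i<length xs - 1. transition_prob M (xs ! i, xs ! Suc i))"
  using is_run_measure_run_measure[OF chain assms] by (simp_all add: is_run_measure_def)

section \<open>Conditioning the run measure on the first step\<close>

lemma case_nat_Run: "(s, t) \<in> transitions M \<Longrightarrow> \<pi> \<in> Run M t \<Longrightarrow> case_nat s \<pi> \<in> Run M s"
  by (auto simp: Run_def split: nat.split)

lemma vimage_Cyl:
  assumes "(s, t) \<in> transitions M"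
  shows "case_nat s -` Cyl M s (s # ys) \<inter> Run M t
    = (if ys = [] then Run M t else if hd ys = t then Cyl M t ys else {})"
proof -
  have "case_nat s \<pi> \<in> Cyl M s (s # ys) \<longleftrightarrow> (\<forall>i<length ys. \<pi> i = ys ! i)" if "\<pi> \<in> Run M t" for \<pi>
    using case_nat_Run[OF assms that] by (auto simp: Cyl_def nth_Cons less_Suc_eq_0_disj split: nat.splits)
  moreover have "\<pi> 0 = t" if "\<pi> \<in> Run M t" for \<pi>
    using that by (simp add: Run_def)
  ultimately have "case_nat s -` Cyl M s (s # ys) \<inter> Run M t = {\<pi> \<in> Run M t. \<forall>i<length ys. \<pi> i = ys ! i}"
    and "\<forall>\<pi>\<in>Run M t. ys \<noteq> [] \<longrightarrow> (\<forall>i<length ys. \<pi> i = ys ! i) \<longrightarrow> hd ys = t"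
    by (auto simp: hd_conv_nth) (metis length_greater_0_conv)
  then show ?thesis
    by (auto simp: Cyl_def)
qed

lemma measurable_case_nat_Run:
  assumes "(s, t) \<in> transitions M"
  shows "case_nat s \<in> measurable (run_measure M t) (run_measure M s)"
proof (rule measurable_sigma_sets)
  note st = transitions_states[OF assms]
  show "sets (run_measure M s) = sigma_sets (Run M s) {Cyl M s xs |xs. finite_path M s xs}"
    using st by (simp add: run_measure)
  show "{Cyl M s xs |xs. finite_path M s xs} \<subseteq> Pow (Run M s)"
    by (auto simp: Cyl_def)
  show "case_nat s \<in> space (run_measure M t) \<rightarrow> Run M s"
    using st case_nat_Run[OF assms] by (auto simp: run_measure)
  fix E assume "E \<in> {Cyl M s xs |xs. finite_path M s xs}"
  then obtain xs where xs: "finite_path M s xs" "E = Cyl M s xs"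
    by blast
  then obtain ys where "xs = s # ys"
    by (cases xs) (auto simp: finite_path_Cons finite_path_Nil)
  with xs have ys: "finite_path M s (s # ys)" "E = Cyl M s (s # ys)"
    by simp_all
  have "finite_path M (hd ys) ys" if "ys \<noteq> []"
    using ys(1) that by (simp add: finite_path_Cons)
  then have "Cyl M t ys \<in> sets (run_measure M t)" if "ys \<noteq> []" "hd ys = t"
    using that st by (auto simp: run_measure intro!: sigma_sets.Basic)
  then show "case_nat s -` E \<inter> space (run_measure M t) \<in> sets (run_measure M t)"
    using st sets.top[of "run_measure M t"] by (simp add: ys(2) run_measure(2) vimage_Cyl[OF assms])
qed

text \<open>The right-hand side is itself a measure in \<open>E\<close>. It agrees with the run
  measure on cylinders, where prefixing \<open>s\<close> splits off the first factor of the product,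
  so uniqueness identifies the two.\<close>

lemma emeasure_run_measure_step:
  assumes s: "s \<in> states M" and E: "E \<in> sets (run_measure M s)"
  shows "emeasure (run_measure M s) E = (\<Sum>t | (s, t) \<in> transitions M.
    ennreal (transition_prob M (s, t)) * emeasure (run_measure M t) (case_nat s -` E \<inter> Run M t))"
proof -
  let ?A = "{t. (s, t) \<in> transitions M}" and ?G = "{Cyl M s xs |xs. finite_path M s xs}"
  define P where "P t = transition_prob M (s, t)" for t
  define f where "f t = distr (run_measure M t) (run_measure M s) (case_nat s)" for t
  define \<mu>' where "\<mu>' X = (\<Sum>t\<in>?A. ennreal (P t) * emeasure (f t) X)" for X
  define \<mu> where "\<mu> = measure_of (Run M s) ?G \<mu>'"
  have fin: "finite ?A"
    by (rule finite_succ[OF s])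
  have f: "emeasure (f t) X = emeasure (run_measure M t) (case_nat s -` X \<inter> Run M t)"
    if "t \<in> ?A" "X \<in> sets (run_measure M s)" for t X
    using that measurable_case_nat_Run[of s t] transitions_states[of s t]
    by (simp add: f_def emeasure_distr run_measure(2))
  have G: "?G \<subseteq> Pow (Run M s)"
    by (auto simp: Cyl_def)
  have sets: "sets \<mu> = sets (run_measure M s)"
    unfolding \<mu>_def using G s by (simp add: run_measure(3))
  have pos: "positive (sets \<mu>) \<mu>'"
    by (simp add: positive_def \<mu>'_def)
  have add: "countably_additive (sets \<mu>) \<mu>'"
  proof (rule countably_additiveI)
    fix X :: "nat \<Rightarrow> (nat \<Rightarrow> 's) set"
    assume X: "range X \<subseteq> sets \<mu>" "disjoint_family X" "\<Union> (range X) \<in> sets \<mu>"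
    have "(\<Sum>i. \<mu>' (X i)) = (\<Sum>t\<in>?A. \<Sum>i. ennreal (P t) * emeasure (f t) (X i))"
      unfolding \<mu>'_def by (rule suminf_sum) (rule summableI)
    also have "\<dots> = (\<Sum>t\<in>?A. ennreal (P t) * emeasure (f t) (\<Union> (range X)))"
      using X sets by (intro sum.cong) (simp_all add: ennreal_suminf_cmult suminf_emeasure f_def)
    finally show "(\<Sum>i. \<mu>' (X i)) = \<mu>' (\<Union> (range X))"
      by (simp add: \<mu>'_def)
  qed
  have em: "emeasure \<mu> X = \<mu>' X" if "X \<in> sets (run_measure M s)" for X
    using that emeasure_measure_of[OF \<mu>_def G pos add] by (simp add: sets)
  have sum1: "(\<Sum>t\<in>?A. P t) = 1"
  proof -
    have "(P has_sum 1) ?A"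
      using chain s unfolding is_markov_chain_def P_def by blast
    then show ?thesis
      using fin by (simp add: has_sum_finite_iff)
  qed
  have nonneg: "0 \<le> P t" if "t \<in> ?A" for t
    using transition_prob_pos that by (simp add: P_def less_imp_le)
  have Run: "Cyl M s [s] = Run M s" "finite_path M s [s]"
    by (auto simp: Cyl_def Run_def finite_path_def)
  have cyl: "Cyl M s xs \<in> sets (run_measure M s)" if "finite_path M s xs" for xs
    using that s by (auto simp: run_measure intro!: sigma_sets.Basic)
  have emc: "emeasure \<mu> (Cyl M s xs) = ennreal (\<Prod>i<length xs - 1. transition_prob M (xs ! i, xs ! Suc i))"
    if "finite_path M s xs" for xs
  proof -
    from that obtain ys where ys: "xs = s # ys"
      by (cases xs) (auto simp: finite_path_Cons finite_path_Nil)
    have "emeasure \<mu> (Cyl M s xs) = (\<Sum>t\<in>?A. ennreal (P t) * emeasure (run_measure M t)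
        (if ys = [] then Run M t else if hd ys = t then Cyl M t ys else {}))"
      using that cyl[OF that] by (simp add: em \<mu>'_def f vimage_Cyl ys)
    also have "\<dots> = ennreal (\<Prod>i<length xs - 1. transition_prob M (xs ! i, xs ! Suc i))"
    proof (cases ys)
      case Nil
      have "emeasure (run_measure M t) (Run M t) = 1" if "t \<in> ?A" for t
        using prob_space.emeasure_space_1[OF run_measure(1)] transitions_states[of s t] that
        by (metis mem_Collect_eq run_measure(2))
      then have "(\<Sum>t\<in>?A. ennreal (P t) * emeasure (run_measure M t) (Run M t)) = (\<Sum>t\<in>?A. ennreal (P t))"
        by (intro sum.cong) auto
      also have "\<dots> = 1"
        by (subst sum_ennreal) (use nonneg sum1 in auto)
      finally show ?thesis
        by (simp add: Nil ys)
    next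
      case (Cons t zs)
      have t: "t \<in> ?A"
        using that unfolding ys Cons by (simp add: finite_path_Cons)
      have path: "finite_path M t ys"
        using that unfolding ys Cons by (simp add: finite_path_Cons)
      have "(\<Sum>t'\<in>?A. ennreal (P t') * emeasure (run_measure M t')
        (if ys = [] then Run M t' else if hd ys = t' then Cyl M t' ys else {}))
        = (\<Sum>t'\<in>?A. if t = t' then ennreal (P t) * emeasure (run_measure M t) (Cyl M t ys) else 0)"
        by (intro sum.cong) (auto simp: Cons)
      also have "\<dots> = ennreal (P t) * emeasure (run_measure M t) (Cyl M t ys)"
        using t fin by simp
      also have "\<dots> = ennreal (P t) * ennreal (\<Prod>i<length ys - 1. transition_prob M (ys ! i, ys ! Suc i))"
        using t transitions_states[of s t] path by (simp add: run_measure(4))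
      also have "\<dots> = ennreal (P t * (\<Prod>i<length ys - 1. transition_prob M (ys ! i, ys ! Suc i)))"
        using nonneg[OF t] by (simp add: ennreal_mult')
      also have "P t * (\<Prod>i<length ys - 1. transition_prob M (ys ! i, ys ! Suc i))
          = (\<Prod>i<length xs - 1. transition_prob M (xs ! i, xs ! Suc i))"
        by (simp add: ys Cons P_def prod.lessThan_Suc_shift del: prod.lessThan_Suc)
      finally show ?thesis .
    qed
    finally show ?thesis .
  qed
  have "is_run_measure M s \<mu>"
    unfolding is_run_measure_def
  proof (intro conjI allI impI emc)
    show sp: "space \<mu> = Run M s"
      using G by (simp add: \<mu>_def space_measure_of)
    show "sets \<mu> = sigma_sets (Run M s) ?G"
      using sets s by (simp add: run_measure(3))
    show "prob_space \<mu>"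
      using emc[OF Run(2)] by (intro prob_spaceI) (simp add: sp Run(1))
  qed
  then have "run_measure M s = \<mu>"
    by (rule run_measure_unique[OF is_run_measure_run_measure[OF chain s]])
  then show ?thesis
    using em[OF E] E by (simp add: \<mu>'_def f P_def)
qed

lemma measure_run_measure_step:
  assumes s: "s \<in> states M" and E: "E \<in> sets (run_measure M s)"
  shows "measure (run_measure M s) E = (\<Sum>t | (s, t) \<in> transitions M.
    transition_prob M (s, t) * measure (run_measure M t) (case_nat s -` E \<inter> Run M t))"
proof -
  let ?A = "{t. (s, t) \<in> transitions M}"
  have em: "emeasure (run_measure M t) X = ennreal (measure (run_measure M t) X)" if "t \<in> states M" for t X
    using run_measure(1)[OF that] by (simp add: finite_measure.emeasure_eq_measure prob_space.finite_measure)
  have "ennreal (measure (run_measure M s) E) = (\<Sum>t\<in>?A.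
      ennreal (transition_prob M (s, t) * measure (run_measure M t) (case_nat s -` E \<inter> Run M t)))"
    unfolding em[OF s, symmetric] emeasure_run_measure_step[OF assms]
    using transitions_states[of s] transition_prob_pos
    by (intro sum.cong) (auto simp: em ennreal_mult' less_imp_le)
  also have "\<dots> = ennreal (\<Sum>t\<in>?A.
      transition_prob M (s, t) * measure (run_measure M t) (case_nat s -` E \<inter> Run M t))"
    using transition_prob_pos by (intro sum_ennreal) (simp add: less_imp_le)
  finally show ?thesis
    using transition_prob_pos by (subst (asm) ennreal_inj) (auto intro!: sum_nonneg simp: less_imp_le)
qed

section \<open>Until probabilities\<close>

definition until_prob :: "('p \<Rightarrow> 's set) \<Rightarrow> 'p state_formula \<Rightarrow> 'p state_formula \<Rightarrow> 's \<Rightarrow> real" where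
  "until_prob \<nu> \<Phi> \<Psi> s = measure (run_measure M s) {\<pi> \<in> Run M s. path_sat M \<nu> (Until \<Phi> \<Psi>) \<pi>}"

lemma sat_Prob_Until: "sat M \<nu> (Prob c r (Until \<Phi> \<Psi>)) s \<longleftrightarrow> compare c (until_prob \<nu> \<Phi> \<Psi> s) (of_rat r)"
  by (simp add: until_prob_def)

lemma until_prob_1:
  assumes "s \<in> states M" "sat M \<nu> \<Psi> s"
  shows "until_prob \<nu> \<Phi> \<Psi> s = 1"
proof -
  have "{\<pi> \<in> Run M s. path_sat M \<nu> (Until \<Phi> \<Psi>) \<pi>} = Run M s"
    using assms(2) by (auto simp: Run_def intro!: exI[of _ 0])
  then show ?thesis
    using prob_space.prob_space[OF run_measure(1)[OF assms(1)]] run_measure(2)[OF assms(1)]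
    by (simp add: until_prob_def)
qed

lemma until_prob_0:
  assumes "\<not> sat M \<nu> \<Phi> s" "\<not> sat M \<nu> \<Psi> s"
  shows "until_prob \<nu> \<Phi> \<Psi> s = 0"
proof -
  have "\<not> path_sat M \<nu> (Until \<Phi> \<Psi>) \<pi>" if "\<pi> \<in> Run M s" for \<pi>
  proof
    assume "path_sat M \<nu> (Until \<Phi> \<Psi>) \<pi>"
    then obtain k where "sat M \<nu> \<Psi> (\<pi> k)" "\<forall>j<k. sat M \<nu> \<Phi> (\<pi> j)"
      by auto
    with assms that show False
      by (cases k) (auto simp: Run_def)
  qed
  then have "{\<pi> \<in> Run M s. path_sat M \<nu> (Until \<Phi> \<Psi>) \<pi>} = {}"
    by blast
  then show ?thesis
    by (simp only: until_prob_def measure_empty)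
qed

lemma until_prob_step:
  assumes s: "s \<in> states M" and "sat M \<nu> \<Phi> s" "\<not> sat M \<nu> \<Psi> s"
  shows "until_prob \<nu> \<Phi> \<Psi> s =
    (\<Sum>t | (s, t) \<in> transitions M. transition_prob M (s, t) * until_prob \<nu> \<Phi> \<Psi> t)"
proof -
  have iff: "path_sat M \<nu> (Until \<Phi> \<Psi>) (case_nat s \<pi>) \<longleftrightarrow> path_sat M \<nu> (Until \<Phi> \<Psi>) \<pi>" for \<pi>
  proof
    assume "path_sat M \<nu> (Until \<Phi> \<Psi>) (case_nat s \<pi>)"
    then obtain k where k: "sat M \<nu> \<Psi> (case_nat s \<pi> k)" "\<forall>j<k. sat M \<nu> \<Phi> (case_nat s \<pi> j)"
      by auto
    with assms obtain l where "k = Suc l"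
      by (cases k) auto
    with k show "path_sat M \<nu> (Until \<Phi> \<Psi>) \<pi>"
      by (auto intro!: exI[of _ l] dest: spec[of _ "Suc _"])
  next
    assume "path_sat M \<nu> (Until \<Phi> \<Psi>) \<pi>"
    then obtain k where "sat M \<nu> \<Psi> (\<pi> k)" "\<forall>j<k. sat M \<nu> \<Phi> (\<pi> j)"
      by auto
    with assms show "path_sat M \<nu> (Until \<Phi> \<Psi>) (case_nat s \<pi>)"
      by (auto intro!: exI[of _ "Suc k"] split: nat.split)
  qed
  have "case_nat s -` {\<pi> \<in> Run M s. path_sat M \<nu> (Until \<Phi> \<Psi>) \<pi>} \<inter> Run M t
      = {\<pi> \<in> Run M t. path_sat M \<nu> (Until \<Phi> \<Psi>) \<pi>}" if "(s, t) \<in> transitions M" for t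
    using case_nat_Run[OF that] iff by blast
  then show ?thesis
    unfolding until_prob_def measure_run_measure_step[OF s measurable_path_sat[OF chain s]]
    by (intro sum.cong) simp_all
qed

text \<open>A finite path to the target already has positive probability, so the threshold 0 asks
  for reachability only. This is what makes an until formula an existential quantifier.\<close>

lemma until_prob_pos_iff:
  assumes "s \<in> states M"
  shows "0 < until_prob \<nu> \<Phi> \<Psi> s \<longleftrightarrow>
    (\<exists>t. (s, t) \<in> {(x, y) \<in> transitions M. sat M \<nu> \<Phi> x}\<^sup>* \<and> sat M \<nu> \<Psi> t)"
    (is "_ \<longleftrightarrow> (\<exists>t. (s, t) \<in> ?R\<^sup>* \<and> _)")
proof
  assume "0 < until_prob \<nu> \<Phi> \<Psi> s"
  then have "{\<pi> \<in> Run M s. path_sat M \<nu> (Until \<Phi> \<Psi>) \<pi>} \<noteq> {}"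
    unfolding until_prob_def by (metis measure_empty less_irrefl)
  then obtain \<pi> k where \<pi>: "\<pi> \<in> Run M s" and k: "sat M \<nu> \<Psi> (\<pi> k)" "\<forall>j<k. sat M \<nu> \<Phi> (\<pi> j)"
    by auto
  have "j \<le> k \<Longrightarrow> (s, \<pi> j) \<in> ?R\<^sup>*" for j
  proof (induction j)
    case 0
    then show ?case using \<pi> by (simp add: Run_def)
  next
    case (Suc j)
    then have "(\<pi> j, \<pi> (Suc j)) \<in> ?R"
      using \<pi> k(2) by (auto simp: Run_def)
    with Suc show ?case
      by (meson Suc_leD rtrancl.rtrancl_into_rtrancl)
  qed
  with k(1) show "\<exists>t. (s, t) \<in> ?R\<^sup>* \<and> sat M \<nu> \<Psi> t"
    by blast
next
  assume "\<exists>t. (s, t) \<in> ?R\<^sup>* \<and> sat M \<nu> \<Psi> t"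
  then obtain t where "(s, t) \<in> ?R\<^sup>*" "sat M \<nu> \<Psi> t"
    by blast
  then show "0 < until_prob \<nu> \<Phi> \<Psi> s"
    using assms
  proof (induction rule: converse_rtrancl_induct)
    case base
    then show ?case by (simp add: until_prob_1)
  next
    case (step x y)
    show ?case
    proof (cases "sat M \<nu> \<Psi> x")
      case True
      with step show ?thesis by (simp add: until_prob_1)
    next
      case False
      have nonneg: "0 \<le> transition_prob M (x, t) * until_prob \<nu> \<Phi> \<Psi> t" if "(x, t) \<in> transitions M" for t
        using transition_prob_pos[OF that] by (simp add: until_prob_def)
      have xy: "(x, y) \<in> transitions M"
        using step by blast
      have "0 < transition_prob M (x, y) * until_prob \<nu> \<Phi> \<Psi> y"
        using transition_prob_pos[OF xy] step transitions_states[OF xy] by simp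
      also have "\<dots> \<le> (\<Sum>t | (x, t) \<in> transitions M. transition_prob M (x, t) * until_prob \<nu> \<Phi> \<Psi> t)"
        using xy nonneg finite_succ[OF step.prems(2)] by (intro member_le_sum) auto
      also have "\<dots> = until_prob \<nu> \<Phi> \<Psi> x"
        using step False by (intro until_prob_step[symmetric]) auto
      finally show ?thesis .
    qed
  qed
qed

end

section \<open>The pushdown system\<close>

text \<open>The rules determine the whole system; bias is produced by formulas that select among
  equally likely outcomes.\<close>

definition uniform_pbpa :: "'a set \<Rightarrow> ('a \<times> 'a list) set \<Rightarrow> 'a pbpa" where
  "uniform_pbpa A R = \<lparr>alphabet = A, rules = R, rule_prob = \<lambda>(X, \<alpha>). 1 / of_nat (card (R `` {X}))\<rparr>"

lemma uniform_pbpa_simps [simp]: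
  "alphabet (uniform_pbpa A R) = A" "rules (uniform_pbpa A R) = R"
  "rule_prob (uniform_pbpa A R) (X, \<alpha>) = 1 / of_nat (card (R `` {X}))"
  by (simp_all add: uniform_pbpa_def)

lemma is_pbpa_uniform_pbpa:
  assumes "finite A" "finite R"
    and "\<And>X \<alpha>. (X, \<alpha>) \<in> R \<Longrightarrow> X \<in> A \<and> \<alpha> \<in> lists A \<and> length \<alpha> \<le> 2"
    and "\<And>X. X \<in> A \<Longrightarrow> \<exists>\<alpha>. (X, \<alpha>) \<in> R"
  shows "is_pbpa (uniform_pbpa A R)"
proof -
  have fin: "finite (R `` {X})" for X
    using assms(2) by (rule finite_Image)
  have card: "0 < card (R `` {X})" if "(X, \<alpha>) \<in> R" for X \<alpha>
    using that fin[of X] by (auto simp: card_gt_0_iff)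
  have "(\<Sum>\<alpha> | (X, \<alpha>) \<in> R. 1 / of_nat (card (R `` {X}))) = (1 :: rat)" if "X \<in> A" for X
  proof -
    have "{\<alpha>. (X, \<alpha>) \<in> R} = R `` {X}"
      by auto
    moreover obtain \<alpha> where "(X, \<alpha>) \<in> R"
      using assms(4) \<open>X \<in> A\<close> by blast
    ultimately show ?thesis
      using card[of X \<alpha>] by simp
  qed
  then show ?thesis
    using assms card by (fastforce simp: is_pbpa_def)
qed

lemma finitely_branching_pbpa_chain:
  assumes "is_pbpa D"
  shows "finitely_branching (pbpa_chain D)"
proof
  show "is_markov_chain (pbpa_chain D)"
    using assms by (rule is_markov_chain_pbpa_chain)
  fix s assume "s \<in> states (pbpa_chain D)"
  have "{t. (s, t) \<in> pbpa_trans D} \<subseteq> insert [] ((\<lambda>(X, \<alpha>). \<alpha> @ tl s) ` rules D)"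
    by (force simp: pbpa_trans_def image_iff)
  then show "finite {t. (s, t) \<in> transitions (pbpa_chain D)}"
    using assms by (auto simp: is_pbpa_def pbpa_chain_def intro: finite_subset)
qed

text \<open>The control symbol \<open>ctrl\<close> either pushes a letter below itself, by way of \<open>push l\<close>, or vanishes and
  starts popping the stack. A letter is popped by way of one of six equally likely outcomes \<open>outcome l i\<close>, so that an
  until formula can choose the probabilities of success, failure and continuation at each letter.\<close>

definition ctrl :: nat where "ctrl = 0"
definition letter :: "nat \<Rightarrow> nat" where "letter l = 8 * l + 1"
definition push :: "nat \<Rightarrow> nat" where "push l = 8 * l + 2"
definition outcome :: "nat \<Rightarrow> nat \<Rightarrow> nat" where "outcome l i = 8 * l + 3 + i"

lemma symbols_distinct [simp]:
  "letter l \<noteq> ctrl" "push l \<noteq> ctrl" "outcome l i \<noteq> ctrl" "ctrl \<noteq> letter l" "ctrl \<noteq> push l" "ctrl \<noteq> outcome l i"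
  "letter l \<noteq> push m" "push m \<noteq> letter l" "letter l = letter m \<longleftrightarrow> l = m" "push l = push m \<longleftrightarrow> l = m"
  by (simp_all add: ctrl_def letter_def push_def outcome_def) presburger+

text \<open>Modulo 8, letters are 1, push symbols 2, and outcomes 3 to 7 and 0. The bound on
  \<open>i\<close> matters: \<open>outcome l 6\<close> would be
  \<open>letter (Suc l)\<close>.\<close>

lemma out_distinct [simp]:
  assumes "i < 6"
  shows "outcome l i \<noteq> letter m" "letter m \<noteq> outcome l i" "outcome l i \<noteq> push m" "push m \<noteq> outcome l i"
    "j < 6 \<Longrightarrow> outcome l i = outcome m j \<longleftrightarrow> l = m \<and> i = j"
  using assms by (simp_all add: letter_def push_def outcome_def) presburger+

definition gadget_alphabet :: "nat \<Rightarrow> nat set" where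
  "gadget_alphabet n =
     insert ctrl (letter ` {..<n} \<union> push ` {..<n} \<union> (\<lambda>(l, i). outcome l i) ` ({..<n} \<times> {..<6}))"

definition gadget_rules :: "nat \<Rightarrow> (nat \<times> nat list) set" where
  "gadget_rules n = insert (ctrl, []) ((\<lambda>l. (ctrl, [push l])) ` {..<n}
     \<union> (\<lambda>l. (push l, [ctrl, letter l])) ` {..<n}
     \<union> (\<lambda>(l, i). (letter l, [outcome l i])) ` ({..<n} \<times> {..<6})
     \<union> (\<lambda>(l, i). (outcome l i, [])) ` ({..<n} \<times> {..<6}))"

definition gadget :: "nat \<Rightarrow> nat pbpa" where
  "gadget n = uniform_pbpa (gadget_alphabet n) (gadget_rules n)"

lemma alphabet_gadget [simp]: "alphabet (gadget n) = gadget_alphabet n"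
  by (simp add: gadget_def)

lemma gadget_alphabet_iff [simp]:
  "ctrl \<in> gadget_alphabet n" "letter l \<in> gadget_alphabet n \<longleftrightarrow> l < n"
  "push l \<in> gadget_alphabet n \<longleftrightarrow> l < n" "i < 6 \<Longrightarrow> outcome l i \<in> gadget_alphabet n \<longleftrightarrow> l < n"
  by (auto simp: gadget_alphabet_def)

lemma finite_gadget_alphabet: "finite (gadget_alphabet n)"
  by (simp add: gadget_alphabet_def)

lemma gadget_rules_Image:
  "gadget_rules n `` {ctrl} = insert [] ((\<lambda>l. [push l]) ` {..<n})"
  "l < n \<Longrightarrow> gadget_rules n `` {push l} = {[ctrl, letter l]}"
  "l < n \<Longrightarrow> gadget_rules n `` {letter l} = (\<lambda>i. [outcome l i]) ` {..<6}"
  "l < n \<Longrightarrow> i < 6 \<Longrightarrow> gadget_rules n `` {outcome l i} = {[]}"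
  by (force simp: gadget_rules_def)+

lemma is_pbpa_gadget: "is_pbpa (gadget n)"
  unfolding gadget_def
proof (rule is_pbpa_uniform_pbpa)
  show "finite (gadget_alphabet n)" "finite (gadget_rules n)"
    by (simp_all add: finite_gadget_alphabet gadget_rules_def)
  show "(X, \<alpha>) \<in> gadget_rules n \<Longrightarrow> X \<in> gadget_alphabet n \<and> \<alpha> \<in> lists (gadget_alphabet n) \<and> length \<alpha> \<le> 2" for X \<alpha>
    by (auto simp: gadget_rules_def)
  fix X assume "X \<in> gadget_alphabet n"
  then have "gadget_rules n `` {X} \<noteq> {}"
    unfolding gadget_alphabet_def by (auto simp: gadget_rules_Image lessThan_empty_iff)
  then show "\<exists>\<alpha>. (X, \<alpha>) \<in> gadget_rules n"
    by blast
qed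

interpretation gadget: finitely_branching "pbpa_chain (gadget n)" for n
  by (rule finitely_branching_pbpa_chain[OF is_pbpa_gadget])

lemma gadget_chain:
  "states (pbpa_chain (gadget n)) = lists (gadget_alphabet n)"
  "(X # \<beta>, t) \<in> transitions (pbpa_chain (gadget n)) \<longleftrightarrow>
     \<beta> \<in> lists (gadget_alphabet n) \<and> (\<exists>\<alpha>\<in>gadget_rules n `` {X}. t = \<alpha> @ \<beta>)"
  by (auto simp: pbpa_chain_def pbpa_trans_def gadget_def)

text \<open>The proposition \<open>p\<close> stands for the set of heads coded by \<open>p\<close>, which spares disjunctions of heads.\<close>

definition gadget_val :: "nat \<Rightarrow> nat \<Rightarrow> nat list set" where
  "gadget_val n p = {X # \<beta> |X \<beta>. X \<in> set_decode p \<inter> gadget_alphabet n \<and> \<beta> \<in> lists (gadget_alphabet n)}"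

definition gadget_AP :: "nat \<Rightarrow> nat set" where
  "gadget_AP n = set_encode ` Pow (gadget_alphabet n)"

lemma finite_gadget_AP: "finite (gadget_AP n)"
  by (simp add: gadget_AP_def finite_gadget_alphabet)

lemma simple_gadget_val: "simple_assignment (gadget_alphabet n) AP (gadget_val n)"
  unfolding simple_assignment_def gadget_val_def by blast

section \<open>Quantifying over pushed words\<close>

definition head_in :: "nat set \<Rightarrow> nat state_formula" where
  "head_in H = Atom (set_encode H)"

abbreviation gsat :: "nat \<Rightarrow> nat state_formula \<Rightarrow> nat list \<Rightarrow> bool" where
  "gsat n \<equiv> sat (pbpa_chain (gadget n)) (gadget_val n)"

lemma gsat_head:
  assumes "H \<subseteq> gadget_alphabet n"
  shows "gsat n (head_in H) [] \<longleftrightarrow> False"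
    "X # \<beta> \<in> lists (gadget_alphabet n) \<Longrightarrow> gsat n (head_in H) (X # \<beta>) \<longleftrightarrow> X \<in> H"
  using assms finite_subset[OF assms finite_gadget_alphabet]
  by (auto simp: head_in_def gadget_val_def)

lemma pctl_head: "H \<subseteq> gadget_alphabet n \<Longrightarrow> pctl_state (gadget_AP n) (head_in H)"
  by (simp add: head_in_def gadget_AP_def)

definition disj :: "'p state_formula \<Rightarrow> 'p state_formula \<Rightarrow> 'p state_formula" where
  "disj \<Phi> \<Psi> = Neg (Conj (Neg \<Phi>) (Neg \<Psi>))"

lemma sat_disj [simp]: "sat M \<nu> (disj \<Phi> \<Psi>) s \<longleftrightarrow> sat M \<nu> \<Phi> s \<or> sat M \<nu> \<Psi> s"
  by (simp add: disj_def)

lemma pctl_disj [simp]: "pctl_state AP (disj \<Phi> \<Psi>) \<longleftrightarrow> pctl_state AP \<Phi> \<and> pctl_state AP \<Psi>"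
  by (simp add: disj_def)

text \<open>Letters are not admissible heads, so a path on which \<open>ctrl\<close> has vanished is
  lost, as is one about to push a letter outside \<open>B\<close>. Asking for \<open>ctrl\<close> at
  the target keeps intermediate stacks from satisfying \<Phi>.\<close>

definition some_word :: "nat set \<Rightarrow> nat state_formula \<Rightarrow> nat state_formula" where
  "some_word B \<Phi> = Prob Greater 0 (Until (head_in (insert ctrl (push ` B))) (Conj (head_in {ctrl}) \<Phi>))"

lemma pctl_some_word:
  "B \<subseteq> {..<n} \<Longrightarrow> pctl_state (gadget_AP n) \<Phi> \<Longrightarrow> pctl_state (gadget_AP n) (some_word B \<Phi>)"
  by (auto simp: some_word_def intro!: pctl_head)

definition conf :: "nat list \<Rightarrow> nat list" where
  "conf \<alpha> = ctrl # map letter \<alpha>"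

lemma conf_in_lists: "\<alpha> \<in> lists {..<n} \<Longrightarrow> conf \<alpha> \<in> lists (gadget_alphabet n)"
  by (auto simp: conf_def)

lemma gsat_some_word:
  assumes B: "B \<subseteq> {..<n}" and \<alpha>: "\<alpha> \<in> lists {..<n}"
  shows "gsat n (some_word B \<Phi>) (conf \<alpha>) \<longleftrightarrow> (\<exists>w\<in>lists B. gsat n \<Phi> (conf (w @ \<alpha>)))"
proof -
  let ?H = "insert ctrl (push ` B)"
  let ?R = "{(x, y) \<in> transitions (pbpa_chain (gadget n)). gsat n (head_in ?H) x}"
  have H: "?H \<subseteq> gadget_alphabet n"
    using B by auto
  have syms: "map letter (w @ \<alpha>) \<in> lists (gadget_alphabet n)" if "w \<in> lists B" for w
    using that \<alpha> subsetD[OF B] by (fastforce simp: in_lists_conv_set)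
  note head_in = gsat_head[OF H] gsat_head[of "{ctrl}" n]
  have "gsat n (some_word B \<Phi>) (conf \<alpha>) \<longleftrightarrow>
    (\<exists>t. (conf \<alpha>, t) \<in> ?R\<^sup>* \<and> gsat n (Conj (head_in {ctrl}) \<Phi>) t)"
    using gadget.until_prob_pos_iff[of "conf \<alpha>" n] conf_in_lists[OF \<alpha>]
    by (simp add: some_word_def gadget.sat_Prob_Until gadget_chain del: sat.simps)
  also have "\<dots> \<longleftrightarrow> (\<exists>w\<in>lists B. gsat n \<Phi> (conf (w @ \<alpha>)))"
  proof
    assume "\<exists>t. (conf \<alpha>, t) \<in> ?R\<^sup>* \<and> gsat n (Conj (head_in {ctrl}) \<Phi>) t"
    then obtain t where t: "(conf \<alpha>, t) \<in> ?R\<^sup>*" "gsat n (head_in {ctrl}) t" "gsat n \<Phi> t"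
      by auto
    \<comment> \<open>The other two forms lie one step behind a configuration: \<open>ctrl\<close>
      has vanished, or some letter, perhaps outside \<open>B\<close>, is about to be pushed. The
      head condition lets only letters of \<open>B\<close> pass.\<close>
    from t(1) have "\<exists>w\<in>lists B. t \<in> {conf (w @ \<alpha>), map letter (w @ \<alpha>)} \<union> (\<lambda>b. push b # map letter (w @ \<alpha>)) ` {..<n}"
    proof (induction rule: rtrancl_induct)
      case base
      then show ?case by (auto intro!: bexI[of _ "[]"])
    next
      case (step x y)
      then obtain w where w: "w \<in> lists B"
        "x \<in> {conf (w @ \<alpha>), map letter (w @ \<alpha>)} \<union> (\<lambda>b. push b # map letter (w @ \<alpha>)) ` {..<n}"
        by blast
      have xy: "(x, y) \<in> transitions (pbpa_chain (gadget n))" "gsat n (head_in ?H) x"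
        using step by auto
      from w(2) consider "x = conf (w @ \<alpha>)" | "x = map letter (w @ \<alpha>)"
        | b where "b < n" "x = push b # map letter (w @ \<alpha>)"
        by blast
      then show ?case
      proof cases
        case 1
        with xy(1) have "y \<in> insert (map letter (w @ \<alpha>)) ((\<lambda>b. push b # map letter (w @ \<alpha>)) ` {..<n})"
          by (auto simp: conf_def gadget_chain(2) gadget_rules_Image)
        with w(1) show ?thesis by blast
      next
        case 2
        with xy(2) syms[OF w(1)] show ?thesis
          by (cases "w @ \<alpha>") (auto simp: head_in)
      next
        case 3
        then have "b \<in> B" "y = conf ((b # w) @ \<alpha>)"
          using xy syms[OF w(1)] by (auto simp: head_in conf_def gadget_chain(2) gadget_rules_Image)
        with w(1) show ?thesis
          by (intro bexI[of _ "b # w"]) auto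
      qed
    qed
    then obtain w where w: "w \<in> lists B"
      "t \<in> {conf (w @ \<alpha>), map letter (w @ \<alpha>)} \<union> (\<lambda>b. push b # map letter (w @ \<alpha>)) ` {..<n}"
      by blast
    have "t = conf (w @ \<alpha>)"
      using w(2) t(2) syms[OF w(1)] by (cases "w @ \<alpha>") (auto simp: head_in in_lists_conv_set)
    with w(1) t(3) show "\<exists>w\<in>lists B. gsat n \<Phi> (conf (w @ \<alpha>))"
      by blast
  next
    assume "\<exists>w\<in>lists B. gsat n \<Phi> (conf (w @ \<alpha>))"
    then obtain w where w: "w \<in> lists B" "gsat n \<Phi> (conf (w @ \<alpha>))"
      by blast
    from w(1) have "(conf \<alpha>, conf (w @ \<alpha>)) \<in> ?R\<^sup>*"
    proof (induction w)
      case (Cons b w)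
      then have b: "b \<in> B" "b < n" and wB: "w \<in> lists B"
        using B by auto
      let ?m = "map letter (w @ \<alpha>)"
      have "(conf (w @ \<alpha>), push b # ?m) \<in> ?R" "(push b # ?m, conf ((b # w) @ \<alpha>)) \<in> ?R"
        using b syms[OF wB] by (auto simp: head_in conf_def gadget_chain(2) gadget_rules_Image)
      with Cons.IH show ?case
        by (meson rtrancl.rtrancl_into_rtrancl)
    qed simp
    moreover have "gsat n (Conj (head_in {ctrl}) \<Phi>) (conf (w @ \<alpha>))"
      using w syms[OF w(1)] by (auto simp: conf_def head_in)
    ultimately show "\<exists>t. (conf \<alpha>, t) \<in> ?R\<^sup>* \<and> gsat n (Conj (head_in {ctrl}) \<Phi>) t"
      by blast
  qed
  finally show ?thesis .
qed

section \<open>Affine maps computed while popping\<close>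

text \<open>A track gives each letter the number of outcomes that succeed and the number of outcomes that go on.\<close>

type_synonym track = "nat \<Rightarrow> nat \<times> nat"

text \<open>Push symbols are not admissible, so only the branch in which \<open>ctrl\<close>
  vanishes counts. The empty stack has no head and fails, whence
  \<open>track_val T [] = 0\<close>.\<close>

definition track_path :: "nat \<Rightarrow> track \<Rightarrow> nat path_formula" where
  "track_path n T = Until
     (head_in (insert ctrl (letter ` {..<n} \<union> {outcome l i |l i. l < n \<and> i < 6 \<and> i < snd (T l)})))
     (head_in {outcome l i |l i. l < n \<and> i < 6 \<and> snd (T l) \<le> i \<and> i < snd (T l) + fst (T l)})"

primrec track_val :: "track \<Rightarrow> nat list \<Rightarrow> real" where
  "track_val T [] = 0"
| "track_val T (l # \<alpha>) = (real (fst (T l)) + real (snd (T l)) * track_val T \<alpha>) / 6"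

lemma gadget_until_prob_step:
  assumes "X # \<beta> \<in> lists (gadget_alphabet n)" "gsat n \<Phi> (X # \<beta>)" "\<not> gsat n \<Psi> (X # \<beta>)"
  shows "gadget.until_prob n (gadget_val n) \<Phi> \<Psi> (X # \<beta>) =
    (\<Sum>\<alpha>\<in>gadget_rules n `` {X}. gadget.until_prob n (gadget_val n) \<Phi> \<Psi> (\<alpha> @ \<beta>)) / card (gadget_rules n `` {X})"
proof -
  let ?A = "gadget_rules n `` {X}"
  have "{t. (X # \<beta>, t) \<in> transitions (pbpa_chain (gadget n))} = (\<lambda>\<alpha>. \<alpha> @ \<beta>) ` ?A"
    using assms(1) by (auto simp: gadget_chain)
  then have "gadget.until_prob n (gadget_val n) \<Phi> \<Psi> (X # \<beta>) =
    (\<Sum>\<alpha>\<in>?A. transition_prob (pbpa_chain (gadget n)) (X # \<beta>, \<alpha> @ \<beta>) * gadget.until_prob n (gadget_val n) \<Phi> \<Psi> (\<alpha> @ \<beta>))"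
    using gadget.until_prob_step[of "X # \<beta>" n "gadget_val n" \<Phi> \<Psi>] assms
    by (simp add: gadget_chain sum.reindex inj_on_def)
  also have "\<dots> = (\<Sum>\<alpha>\<in>?A. gadget.until_prob n (gadget_val n) \<Phi> \<Psi> (\<alpha> @ \<beta>) / card ?A)"
    by (intro sum.cong) (auto simp: pbpa_chain_def gadget_def of_rat_divide)
  finally show ?thesis
    by (simp add: sum_divide_distrib)
qed

text \<open>The factor 1 / (n + 1) is the probability that \<open>ctrl\<close> vanishes at once: it
  has \<open>n\<close> rules that push and one that starts popping.\<close>

lemma track_prob:
  assumes \<alpha>: "\<alpha> \<in> lists {..<n}" and T: "\<And>l. fst (T l) + snd (T l) \<le> 6"
  shows "sat (pbpa_chain (gadget n)) (gadget_val n) (Prob c r (track_path n T)) (conf \<alpha>)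
    \<longleftrightarrow> compare c (track_val T \<alpha> / (n + 1)) (of_rat r)"
proof -
  define P where "P = insert ctrl (letter ` {..<n} \<union> {outcome l i |l i. l < n \<and> i < 6 \<and> i < snd (T l)})"
  define W where "W = {outcome l i |l i. l < n \<and> i < 6 \<and> snd (T l) \<le> i \<and> i < snd (T l) + fst (T l)}"
  define pr where "pr = gadget.until_prob n (gadget_val n) (head_in P) (head_in W)"
  have PW: "P \<subseteq> gadget_alphabet n" "W \<subseteq> gadget_alphabet n"
    by (auto simp: P_def W_def)
  note head_in = gsat_head[OF PW(1)] gsat_head[OF PW(2)]
  have mem: "ctrl \<in> P" "ctrl \<notin> W" "push l \<notin> P" "push l \<notin> W"
    "letter l \<notin> W" "l < n \<Longrightarrow> letter l \<in> P"
    "l < n \<Longrightarrow> i < 6 \<Longrightarrow> outcome l i \<in> P \<longleftrightarrow> i < snd (T l)"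
    "l < n \<Longrightarrow> i < 6 \<Longrightarrow> outcome l i \<in> W \<longleftrightarrow> snd (T l) \<le> i \<and> i < snd (T l) + fst (T l)" for l i
    by (auto simp: P_def W_def)
  have pr: "pr (map letter \<alpha>) = track_val T \<alpha>"
    using \<alpha>
  proof (induction \<alpha>)
    case Nil
    then show ?case
      by (simp add: pr_def gadget.until_prob_0 head_in del: sat.simps)
  next
    case (Cons l \<alpha>)
    then have l: "l < n" and m: "map letter \<alpha> \<in> lists (gadget_alphabet n)"
      by auto
    have outcome: "pr (outcome l i # map letter \<alpha>) = (if i < snd (T l) then track_val T \<alpha> else if i < snd (T l) + fst (T l) then 1 else 0)"
      if "i < 6" for i
    proof -
      have s: "outcome l i # map letter \<alpha> \<in> lists (gadget_alphabet n)"
        using that l m by simp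
      consider "i < snd (T l)" | "\<not> i < snd (T l)" "i < snd (T l) + fst (T l)" | "\<not> i < snd (T l) + fst (T l)"
        by linarith
      then show ?thesis
      proof cases
        case 1
        then have "pr (outcome l i # map letter \<alpha>) = pr (map letter \<alpha>)"
          using s l that unfolding pr_def
          by (subst gadget_until_prob_step) (auto simp: head_in mem gadget_rules_Image)
        with 1 Cons show ?thesis by simp
      next
        case 2
        then show ?thesis
          using s l that unfolding pr_def
          by (subst gadget.until_prob_1) (auto simp: head_in mem gadget_chain)
      next
        case 3
        then show ?thesis
          using s l that unfolding pr_def
          by (subst gadget.until_prob_0) (auto simp: head_in mem gadget_chain)
      qed
    qed
    have "pr (letter l # map letter \<alpha>) = (\<Sum>i<6. pr (outcome l i # map letter \<alpha>)) / 6"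
      using l m unfolding pr_def
      by (subst gadget_until_prob_step)
        (auto simp: head_in mem gadget_rules_Image sum.reindex inj_on_def card_image)
    also have "(\<Sum>i<6. pr (outcome l i # map letter \<alpha>)) = (\<Sum>i<6. if i < snd (T l) then track_val T \<alpha> else if i < snd (T l) + fst (T l) then 1 else 0)"
      by (intro sum.cong) (auto simp: outcome)
    also have "\<dots> = snd (T l) * track_val T \<alpha> + fst (T l)"
    proof -
      let ?f = "\<lambda>i. if i < snd (T l) then track_val T \<alpha> else if i < snd (T l) + fst (T l) then 1 else 0"
      have "sum ?f {..<6} = sum ?f {0..<snd (T l)} + sum ?f {snd (T l)..<snd (T l) + fst (T l)}
          + sum ?f {snd (T l) + fst (T l)..<6}"
        unfolding lessThan_atLeast0 using T[of l]
        by (subst sum.atLeastLessThan_concat, simp, simp, subst sum.atLeastLessThan_concat) (simp_all only: le_add1 add.commute)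
      also have "\<dots> = (\<Sum>i\<in>{0..<snd (T l)}. track_val T \<alpha>) + (\<Sum>i\<in>{snd (T l)..<snd (T l) + fst (T l)}. 1)
          + (\<Sum>i\<in>{snd (T l) + fst (T l)..<6}. 0)"
        by (intro arg_cong2[of _ _ _ _ "(+)"] sum.cong) auto
      finally show ?thesis
        by simp
    qed
    finally show ?case
      by (simp add: add.commute)
  qed
  have m: "map letter \<alpha> \<in> lists (gadget_alphabet n)"
    using \<alpha> by auto
  have "pr (conf \<alpha>) = (\<Sum>\<gamma>\<in>gadget_rules n `` {ctrl}. pr (\<gamma> @ map letter \<alpha>)) / card (gadget_rules n `` {ctrl})"
    using m unfolding pr_def conf_def by (intro gadget_until_prob_step) (auto simp: head_in mem)
  also have "card (gadget_rules n `` {ctrl}) = n + 1"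
    by (subst gadget_rules_Image) (simp add: card_insert_if card_image inj_on_def image_iff)
  also have "(\<Sum>\<gamma>\<in>gadget_rules n `` {ctrl}. pr (\<gamma> @ map letter \<alpha>)) = pr (map letter \<alpha>) + (\<Sum>l<n. pr (push l # map letter \<alpha>))"
    unfolding gadget_rules_Image by (subst sum.insert) (auto simp: sum.reindex inj_on_def)
  also have "(\<Sum>l<n. pr (push l # map letter \<alpha>)) = 0"
    using m unfolding pr_def by (intro sum.neutral) (auto intro!: gadget.until_prob_0 simp: head_in mem in_lists_conv_set)
  finally have "pr (conf \<alpha>) = track_val T \<alpha> / (n + 1)"
    by (simp add: pr)
  then show ?thesis
    unfolding track_path_def gadget.sat_Prob_Until P_def W_def pr_def by simp
qed

lemma pctl_track:
  "0 \<le> r \<Longrightarrow> r \<le> 1 \<Longrightarrow> pctl_state (gadget_AP n) (Prob c r (track_path n T))"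
  by (auto simp: track_path_def intro!: pctl_head)

section \<open>Interpreting arithmetic\<close>

definition dyadic :: "real \<Rightarrow> bool" where
  "dyadic y \<longleftrightarrow> (\<exists>k m. k \<le> 2 ^ m \<and> y = real k / 2 ^ m)"

lemma dyadicI: "k \<le> 2 ^ m \<Longrightarrow> y = real k / 2 ^ m \<Longrightarrow> dyadic y"
  unfolding dyadic_def by blast

lemma dyadicE:
  assumes "dyadic y"
  obtains k m where "k \<le> 2 ^ m" "y = real k / 2 ^ m"
  using assms unfolding dyadic_def by blast

lemma dyadic_0: "dyadic 0" and dyadic_1: "dyadic 1"
  by (rule dyadicI[of 0 0]; simp) (rule dyadicI[of 1 0]; simp)

lemma dyadic_half:
  assumes "dyadic y"
  shows "dyadic (y / 2)" "dyadic ((1 + y) / 2)"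
proof -
  from assms obtain k m where km: "k \<le> 2 ^ m" "y = real k / 2 ^ m"
    by (rule dyadicE)
  show "dyadic (y / 2)"
    using km by (intro dyadicI[of k "Suc m"]) auto
  show "dyadic ((1 + y) / 2)"
    using km by (intro dyadicI[of "2 ^ m + k" "Suc m"]) (auto simp: field_simps)
qed

text \<open>The pairs give the constants 0, 1/2, 1 and the maps y / 2, (1 + y) / 2, y, which
  preserve dyadic numbers in the unit interval. Certificate digits are not among them: the lemma
  serves stacks on which none has been pushed yet.\<close>

lemma dyadic_val:
  assumes "\<And>l. l \<in> set \<alpha> \<Longrightarrow> T l \<in> {(0, 0), (3, 0), (6, 0), (0, 3), (3, 3), (0, 6)}"
  shows "dyadic (track_val T \<alpha>)"
  using assms
proof (induction \<alpha>)
  case (Cons l \<alpha>)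
  then have IH: "dyadic (track_val T \<alpha>)"
    by simp
  have "dyadic (1 / 2)"
    using dyadic_half(1)[OF dyadic_1] .
  moreover have "track_val T (l # \<alpha>) \<in> {0, 1 / 2, 1, track_val T \<alpha> / 2, (1 + track_val T \<alpha>) / 2, track_val T \<alpha>}"
    using Cons.prems[of l] by (auto simp: field_simps)
  ultimately show ?case
    using IH dyadic_0 dyadic_1 dyadic_half[OF IH] by (metis empty_iff insert_iff)
qed (simp add: dyadic_0)

text \<open>The digits 1, 2, 3 on top of the stack map \<open>y = k / 2\<^bsup>m+2\<^esup>\<close> to \<open>(4 y + c - 1) / 6\<close>, which
  is \<open>k + (c - 1) 2\<^sup>m\<close> over \<open>3 * 2\<^bsup>m+1\<^esup>\<close>. A suitable digit makes the numerator divisible by 3 and so lowers the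
  power of 2 in the denominator.\<close>

fun cert_val :: "nat list \<Rightarrow> real \<Rightarrow> real" where
  "cert_val [] y = y"
| "cert_val (c # w) y = (real (c - 1) + 4 * cert_val w y) / 6"

lemma cert_val_inj: "cert_val w y = cert_val w z \<Longrightarrow> y = z"
  by (induction w) auto

lemma cert_val_append: "cert_val (v @ w) y = cert_val v (cert_val w y)"
  by (induction v) auto

text \<open>As 2^m is invertible modulo 3, some d in {0, 1, 2} gives k + d 2^m = 3 k'. From k \<le>
  4 * 2^m follows k' \<le> 2 * 2^m, so the value stays in the unit interval. The descent ends at
  denominator 2, which leaves the three constants.\<close>

lemma cert_exists_aux:
  "k \<le> 2 ^ Suc m \<Longrightarrow> \<exists>w\<in>lists {1, 2, 3}. cert_val w (real k / 2 ^ Suc m) \<in> {0, 1 / 2, 1}"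
proof (induction m arbitrary: k)
  case 0
  then have "k \<in> {0, 1, 2}"
    by auto
  then have "cert_val [] (real k / 2 ^ Suc 0) \<in> {0, 1 / 2, 1}"
    by auto
  then show ?case
    by (intro bexI[of _ "[]"]) auto
next
  case (Suc m)
  have "\<exists>d\<in>{0, 1, 2}. 3 dvd k + d * 2 ^ m"
  proof -
    have "(2 ^ m :: nat) mod 3 \<noteq> 0"
      using prime_dvd_power_nat[of 3 2 m] by (auto simp: dvd_eq_mod_eq_0[symmetric])
    then show ?thesis
      by simp presburger
  qed
  then obtain d where d: "d \<in> {0, 1, 2}" and "3 dvd k + d * 2 ^ m" ..
  then obtain k' where k': "k + d * 2 ^ m = 3 * k'"
    by (elim dvdE)
  have "k' \<le> 2 ^ Suc m"
    using k' d Suc.prems by auto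
  from Suc.IH[OF this] obtain w where w: "w \<in> lists {1, 2, 3}" "cert_val w (real k' / 2 ^ Suc m) \<in> {0, 1 / 2, 1}"
    by blast
  have "real k + real d * 2 ^ m = 3 * real k'"
    using arg_cong[OF k', of real] by simp
  then have "cert_val [Suc d] (real k / 2 ^ Suc (Suc m)) = real k' / 2 ^ Suc m"
    by (simp add: field_simps)
  with w d show ?case
    \<comment> \<open>\<open>cert_val\<close> applies the last digit first, the one closest to the
      old stack, so the new digit goes to the end.\<close>
    by (intro bexI[of _ "w @ [Suc d]"]) (auto simp: cert_val_append)
qed

lemma cert_exists:
  assumes "dyadic y"
  shows "\<exists>w\<in>lists {1, 2, 3}. cert_val w y \<in> {0, 1 / 2, 1}"
proof -
  from assms obtain k m where km: "k \<le> 2 ^ m" "y = real k / 2 ^ m"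
    by (rule dyadicE)
  then show ?thesis
    using cert_exists_aux[of "2 * k" m] by simp
qed

definition certifying :: "track \<Rightarrow> bool" where
  "certifying T \<longleftrightarrow> (\<forall>l. fst (T l) + snd (T l) \<le> 6) \<and> T 1 = (0, 4) \<and> T 2 = (1, 4) \<and> T 3 = (2, 4)"

lemma val_cert: "certifying T \<Longrightarrow> w \<in> lists {1, 2, 3} \<Longrightarrow> track_val T (w @ \<alpha>) = cert_val w (track_val T \<alpha>)"
  by (induction w) (auto simp: certifying_def)

definition both_values :: "nat \<Rightarrow> track \<Rightarrow> track \<Rightarrow> rat \<Rightarrow> nat state_formula" where
  "both_values n T T' z = Conj (Prob Equal (z / (of_nat n + 1)) (track_path n T))
     (Prob Equal (z / (of_nat n + 1)) (track_path n T'))"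

text \<open>PCTL compares probabilities with constants only. Two tracks are compared with each other by
  guessing digits that take both values to the same constant; the digits act injectively.\<close>

definition same_value :: "nat \<Rightarrow> track \<Rightarrow> track \<Rightarrow> nat state_formula" where
  "same_value n T T' = some_word {1, 2, 3}
     (disj (both_values n T T' 0) (disj (both_values n T T' (1 / 2)) (both_values n T T' 1)))"

lemma pctl_both_values: "0 \<le> z \<Longrightarrow> z \<le> 1 \<Longrightarrow> pctl_state (gadget_AP n) (both_values n T T' z)"
  unfolding both_values_def pctl_state.simps(3) by (intro conjI pctl_track) (auto simp: field_simps)

lemma pctl_same_value: "3 < n \<Longrightarrow> pctl_state (gadget_AP n) (same_value n T T')"
  unfolding same_value_def by (intro pctl_some_word) (auto simp: pctl_both_values)

lemma gsat_both_values:
  assumes "certifying T" "certifying T'" "\<alpha> \<in> lists {..<n}"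
  shows "gsat n (both_values n T T' z) (conf \<alpha>) \<longleftrightarrow> track_val T \<alpha> = of_rat z \<and> track_val T' \<alpha> = of_rat z"
proof -
  have *: "gsat n (Prob Equal (z / (of_nat n + 1)) (track_path n T)) (conf \<alpha>) \<longleftrightarrow> track_val T \<alpha> = of_rat z"
    if "certifying T" for T
    using that track_prob[OF assms(3), of T Equal "z / (of_nat n + 1)"]
    by (simp add: certifying_def of_rat_divide of_rat_add add.commute[of 1 "real n"] del: sat.simps)
  show ?thesis
    unfolding both_values_def sat.simps(3) using *[OF assms(1)] *[OF assms(2)] by simp
qed

text \<open>Equal values share a certificate, and since digits act injectively, unequal values are
  never sent to the same constant. A certificate is sought only when the values agree, so dyadicity
  is asked of one of them.\<close>

lemma gsat_same_value:
  assumes T: "certifying T" "certifying T'" and \<alpha>: "\<alpha> \<in> lists {..<n}" and "3 < n" and "dyadic (track_val T \<alpha>)"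
  shows "gsat n (same_value n T T') (conf \<alpha>) \<longleftrightarrow> track_val T \<alpha> = track_val T' \<alpha>"
proof -
  have "gsat n (same_value n T T') (conf \<alpha>) \<longleftrightarrow>
    (\<exists>w\<in>lists {1, 2, 3}. gsat n (disj (both_values n T T' 0) (disj (both_values n T T' (1 / 2))
      (both_values n T T' 1))) (conf (w @ \<alpha>)))"
    unfolding same_value_def using \<alpha> \<open>3 < n\<close> by (intro gsat_some_word) auto
  also have "\<dots> \<longleftrightarrow> (\<exists>w\<in>lists {1, 2, 3}. \<exists>z\<in>{0, 1 / 2, 1}. cert_val w (track_val T \<alpha>) = z \<and> cert_val w (track_val T' \<alpha>) = z)"
  proof (rule bex_cong[OF refl])
    fix w :: "nat list" assume w: "w \<in> lists {1, 2, 3}"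
    then have "w @ \<alpha> \<in> lists {..<n}"
      using \<alpha> \<open>3 < n\<close> by (fastforce simp: in_lists_conv_set)
    note both = gsat_both_values[OF T this]
    show "gsat n (disj (both_values n T T' 0) (disj (both_values n T T' (1 / 2)) (both_values n T T' 1))) (conf (w @ \<alpha>))
      \<longleftrightarrow> (\<exists>z\<in>{0, 1 / 2, 1}. cert_val w (track_val T \<alpha>) = z \<and> cert_val w (track_val T' \<alpha>) = z)"
      unfolding sat_disj both val_cert[OF T(1) w] val_cert[OF T(2) w] by (auto simp: of_rat_divide)
  qed
  also have "\<dots> \<longleftrightarrow> track_val T \<alpha> = track_val T' \<alpha>"
    using cert_val_inj cert_exists[OF \<open>dyadic (track_val T \<alpha>)\<close>] by metis
  finally show ?thesis .
qed

definition cert_track :: "track \<Rightarrow> track" where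
  "cert_track T l = (if l \<in> {1, 2, 3} then (l - 1, 4) else T l)"

lemma certifying_cert_track: "(\<And>l. fst (T l) + snd (T l) \<le> 6) \<Longrightarrow> certifying (cert_track T)"
  by (auto simp: certifying_def cert_track_def)

section \<open>Counters as powers of 1/2\<close>

text \<open>The letter 0 marks the bottom of the stack, and the number of letters \<open>9 + i\<close> on the stack is the
  value of the variable \<open>i\<close>. The letters 4 to 8 are auxiliary and appear only above the variables.\<close>

definition count_track :: "nat \<Rightarrow> nat set \<Rightarrow> track" where
  "count_track z A = cert_track (\<lambda>l. if l = 0 then (z, 0) else if l \<in> A then (0, 3) else (0, 6))"

lemma certifying_count_track: "z \<le> 6 \<Longrightarrow> certifying (count_track z A)"
  unfolding count_track_def by (rule certifying_cert_track) auto

lemma val_count_track: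
  "\<beta> \<in> lists {4..} \<Longrightarrow> track_val (count_track z A) (\<beta> @ [0]) = z / 6 / 2 ^ length (filter (\<lambda>l. l \<in> A) \<beta>)"
  by (induction \<beta>) (auto simp: count_track_def cert_track_def)

lemma dyadic_count_track:
  assumes "\<beta> \<in> lists {4..}" "z \<in> {3, 6}"
  shows "dyadic (track_val (count_track z A) (\<beta> @ [0]))"
  using assms by (intro dyadic_val) (auto simp: count_track_def cert_track_def)

text \<open>The bottom letter starts the halving at 1 or, with 3 outcomes of 6, at 1/2. The latter
  adds one to the exponent and so expresses a successor.\<close>

lemma gsat_same_count:
  assumes "\<beta> \<in> lists {4..<n}" "3 < n" "z \<in> {0, 1}"
  shows "gsat n (same_value n (count_track 6 A) (count_track (if z = 0 then 6 else 3) B)) (conf (\<beta> @ [0])) \<longleftrightarrow>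
    length (filter (\<lambda>l. l \<in> A) \<beta>) = length (filter (\<lambda>l. l \<in> B) \<beta>) + z"
proof -
  let ?a = "length (filter (\<lambda>l. l \<in> A) \<beta>)" and ?b = "length (filter (\<lambda>l. l \<in> B) \<beta>)"
  have \<beta>: "\<beta> \<in> lists {4..}" "\<beta> @ [0] \<in> lists {..<n}"
    using assms by (auto simp: in_lists_conv_set)
  have "gsat n (same_value n (count_track 6 A) (count_track (if z = 0 then 6 else 3) B)) (conf (\<beta> @ [0])) \<longleftrightarrow>
     track_val (count_track 6 A) (\<beta> @ [0]) = track_val (count_track (if z = 0 then 6 else 3) B) (\<beta> @ [0])"
    using \<beta> assms by (intro gsat_same_value certifying_count_track dyadic_count_track) auto
  also have "track_val (count_track (if z = 0 then 6 else 3) B) (\<beta> @ [0]) = 1 / 2 ^ (?b + z)"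
    using assms(3) by (elim insertE) (simp_all add: val_count_track[OF \<beta>(1)])
  also have "track_val (count_track 6 A) (\<beta> @ [0]) = 1 / 2 ^ ?a"
    by (simp add: val_count_track[OF \<beta>(1)])
  also have "1 / 2 ^ ?a = (1 / 2 ^ (?b + z) :: real) \<longleftrightarrow> (2 :: real) ^ ?a = 2 ^ (?b + z)"
    by (simp only: divide_inverse mult_1 inverse_eq_iff_eq)
  also have "\<dots> \<longleftrightarrow> ?a = ?b + z"
    by (rule power_inject_exp) simp
  finally show ?thesis .
qed

section \<open>Multiplication through periodic binary words\<close>

text \<open>Digits are the letters 6 (one) and 7 (zero), most significant digit first.\<close>

fun bin :: "nat list \<Rightarrow> nat" where
  "bin [] = 0"
| "bin (l # w) = (if l = 6 then 2 ^ length w else 0) + bin w"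

lemma bin_append: "bin (v @ w) = 2 ^ length w * bin v + bin w"
  by (induction v) (auto simp: algebra_simps power_add)

lemma bin_less: "bin w < 2 ^ length w"
  by (induction w) auto

lemma bin_1: "bin w = 1 \<Longrightarrow> count_list w 6 = 1"
proof (induction w)
  case (Cons l w)
  show ?case
  proof (cases "l = 6")
    case True
    with Cons.prems have "2 ^ length w + bin w = 1"
      by simp
    moreover have "1 \<le> (2 :: nat) ^ length w"
      by simp
    ultimately have "(2 :: nat) ^ length w = 1"
      by linarith
    with True show ?thesis
      by simp
  qed (use Cons in simp)
qed simp

text \<open>The equation says that the binary number is \<open>(2\<^sup>n - 1) / (2\<^sup>x - 1)\<close>, where \<open>n\<close> is the number of
  its digits. So its digits are periodic, with one digit 1 in each period of length \<open>x\<close>.\<close>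

lemma periodic_bin:
  assumes "0 < x" "2 ^ x * bin w + 1 = 2 ^ length w + bin w"
  shows "length w = x * count_list w 6"
  using assms(2)
proof (induction w rule: length_induct)
  case (1 w)
  show ?case
  proof (cases "w = []")
    case False
    let ?n = "length w"
    have x2: "2 \<le> (2 :: nat) ^ x" "2 \<le> (2 :: nat) ^ ?n"
      using assms(1) False self_le_power[of 2 x] self_le_power[of 2 ?n] by auto
    \<comment> \<open>Otherwise bin w \<ge> 1 gives 2^x + bin w \<le> 2^x bin w + 1 = 2^n + bin w,
      against 2^n < 2^x, where n is the length of w.\<close>
    have "x \<le> ?n"
    proof (rule ccontr)
      assume "\<not> x \<le> ?n"
      then have "(2 :: nat) ^ ?n < 2 ^ x"
        by simp
      moreover have "bin w \<noteq> 0"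
      proof
        assume "bin w = 0"
        with 1(2) have "(2 :: nat) ^ ?n = 1"
          by simp
        with x2(2) show False
          by simp
      qed
      then have "1 \<le> bin w"
        by simp
      then have "2 ^ x * 1 + bin w \<le> 2 ^ x * bin w + 1"
        using x2(1) by (cases "bin w") (auto simp: algebra_simps)
      ultimately show False
        using 1(2) by simp
    qed
    define a where "a = take (?n - x) w"
    define b where "b = drop (?n - x) w"
    have w: "w = a @ b" and len: "length b = x" "length a + x = ?n"
      using \<open>x \<le> ?n\<close> by (auto simp: a_def b_def)
    have pn: "(2 :: nat) ^ ?n = 2 ^ x * 2 ^ length a"
      using len(2) by (metis add.commute power_add)
    \<comment> \<open>Modulo 2^x this says that the last x digits read as the number 1. Cancelling
      them leaves the same equation for \<open>a\<close>, with x digits and one digit 6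
      fewer.\<close>
    have e: "2 ^ x * bin w + 1 = 2 ^ x * (2 ^ length a + bin a) + bin b"
      using 1(2) by (simp only: pn) (simp add: w bin_append len algebra_simps)
    have "bin b < 2 ^ x"
      using bin_less[of b] len by simp
    then have "bin b = (2 ^ x * (2 ^ length a + bin a) + bin b) mod 2 ^ x"
      by simp
    also have "\<dots> = 1 mod 2 ^ x"
      unfolding e[symmetric] by (rule mod_mult_self4)
    also have "\<dots> = 1"
      using assms(1) by simp
    finally have b1: "bin b = 1" .
    with e have "bin w = 2 ^ length a + bin a"
      using assms(1) by simp
    then have "2 ^ x * bin a + 1 = 2 ^ length a + bin a"
      by (simp add: w bin_append len b1)
    then have "length a = x * count_list a 6"
      using 1(1) assms(1) len by auto
    then show ?thesis
      using len bin_1[OF b1] by (simp add: w)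
  qed simp
qed

text \<open>The witness consists of k copies of the period, x - 1 zeros and a one; appending a copy
  maps the value W to 2^x W + 1.\<close>

lemma periodic_bin_exists:
  assumes "0 < x"
  shows "\<exists>w\<in>lists {6, 7}. 2 ^ x * bin w + 1 = 2 ^ length w + bin w \<and> count_list w 6 = k \<and> length w = x * k"
proof (induction k)
  case (Suc k)
  then obtain w where w: "w \<in> lists {6, 7}" "2 ^ x * bin w + 1 = 2 ^ length w + bin w"
    "count_list w 6 = k" "length w = x * k"
    by blast
  define p :: "nat list" where "p = replicate (x - 1) 7 @ [6]"
  have z: "bin (replicate m 7) = 0" "count_list (replicate m 7) (6 :: nat) = 0" for m
    by (induction m) auto
  have p: "bin p = 1" "length p = x" "count_list p 6 = 1" "p \<in> lists {6, 7}"
    using assms by (auto simp: p_def bin_append z in_lists_conv_set)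
  have b: "bin (w @ p) = 2 ^ x * bin w + 1"
    by (simp add: bin_append p)
  show ?case
  proof (intro bexI conjI)
    show "2 ^ x * bin (w @ p) + 1 = 2 ^ length (w @ p) + bin (w @ p)"
      unfolding b using w(2) by (simp add: p power_add algebra_simps)
    show "count_list (w @ p) 6 = Suc k" "length (w @ p) = x * Suc k" "w @ p \<in> lists {6, 7}"
      using w p by simp_all
  qed
qed (intro bexI[of _ "[]"]; simp)

text \<open>On the stack \<open>4\<^sup>x 8 w 5\<^sup>x \<dots>\<close> with a binary word \<open>w\<close> of value \<open>W = bin w / 2\<^sup>n\<close>, the first track has
  the value \<open>2\<^bsup>-x\<^esup> (1 + W) / 2\<close> and the second one \<open>(W + 2\<^bsup>-n-x\<^esup>) / 2\<close>.\<close>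

definition shift_track :: track where
  "shift_track = cert_track (\<lambda>l. if l \<in> {4, 7} then (0, 3) else if l \<in> {6, 8} then (3, 3) else if l = 5 then (0, 6) else (0, 0))"

definition plain_track :: track where
  "plain_track = cert_track (\<lambda>l. if l \<in> {5, 7, 8} then (0, 3) else if l = 6 then (3, 3) else if l = 4 then (0, 6) else (6, 0))"

lemma certifying_shift_plain: "certifying shift_track" "certifying plain_track"
  unfolding shift_track_def plain_track_def by (rule certifying_cert_track; simp)+

lemma val_half:
  assumes "T 6 = (3, 3)" "T 7 = (0, 3)" "w \<in> lists {6, 7}"
  shows "track_val T (w @ \<alpha>) = (bin w + track_val T \<alpha>) / 2 ^ length w"
  using assms(3) by (induction w) (auto simp: assms field_simps)

lemma val_replicate:
  "T l = (0, 3) \<Longrightarrow> track_val T (replicate x l @ \<alpha>) = track_val T \<alpha> / 2 ^ x"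
  "T l = (0, 6) \<Longrightarrow> track_val T (replicate x l @ \<alpha>) = track_val T \<alpha>"
  by (induction x) auto

text \<open>The letter 8 is a leading digit 1 for one track and 0 for the other; the letters 4 scale
  only the former, the letters 5 only the bottom value 1 of the latter. Multiplying by 2^(x+n+1),
  with n the length of w, clears denominators.\<close>

lemma shift_plain_eq_iff:
  fixes x :: nat and w \<beta> :: "nat list"
  assumes w: "w \<in> lists {6, 7}" and \<beta>: "\<beta> \<in> lists {9..}"
  defines "\<alpha> \<equiv> replicate x 4 @ 8 # w @ replicate x 5 @ \<beta> @ [0]"
  shows "track_val shift_track \<alpha> = track_val plain_track \<alpha> \<longleftrightarrow> 2 ^ x * bin w + 1 = 2 ^ length w + bin w"
proof -
  let ?n = "length w"
  \<comment> \<open>These tracks treat variables and the bottom letter alike, so the first letter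
    below the block settles the value, whatever the variables contain.\<close>
  have "hd (\<beta> @ [0]) \<in> insert 0 {9..}"
    using \<beta> by (cases \<beta>) auto
  then have bot: "track_val shift_track (\<beta> @ [0]) = 0" "track_val plain_track (\<beta> @ [0]) = 1"
    by (cases \<beta>; auto simp: shift_track_def plain_track_def cert_track_def)+
  have s: "shift_track 4 = (0, 3)" "shift_track 5 = (0, 6)" "shift_track 6 = (3, 3)" "shift_track 7 = (0, 3)" "shift_track 8 = (3, 3)"
    by (simp_all add: shift_track_def cert_track_def)
  have p: "plain_track 4 = (0, 6)" "plain_track 5 = (0, 3)" "plain_track 6 = (3, 3)" "plain_track 7 = (0, 3)" "plain_track 8 = (0, 3)"
    by (simp_all add: plain_track_def cert_track_def)
  have "track_val shift_track \<alpha> = (2 ^ ?n + bin w) / (2 * (2 ^ x * 2 ^ ?n))"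
    unfolding \<alpha>_def by (simp add: val_replicate val_half s w bot field_simps)
  moreover have "track_val plain_track \<alpha> = (1 + 2 ^ x * bin w) / (2 * (2 ^ x * 2 ^ ?n))"
    unfolding \<alpha>_def by (simp add: val_replicate val_half p w bot field_simps)
  ultimately have "track_val shift_track \<alpha> = track_val plain_track \<alpha> \<longleftrightarrow>
      (2 ^ ?n + real (bin w)) = 1 + 2 ^ x * real (bin w)"
    by simp
  also have "\<dots> \<longleftrightarrow> real (2 ^ ?n + bin w) = real (2 ^ x * bin w + 1)"
    by simp
  also have "\<dots> \<longleftrightarrow> 2 ^ x * bin w + 1 = 2 ^ ?n + bin w"
    unfolding of_nat_eq_iff by auto
  finally show ?thesis .
qed

text \<open>The first conjuncts force x = e i + 1 letters 4 and 5. The last one makes the guessed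
  digits periodic, so e j ones mean x * e j digits; counting 6, 7 and \<open>9 + k\<close> on one
  track adds e k. One more than the empty count forces a single 8.\<close>

definition atom_formula :: "nat \<Rightarrow> nat \<Rightarrow> nat \<Rightarrow> nat \<Rightarrow> nat \<Rightarrow> nat state_formula" where
  "atom_formula n i j k l = some_word {5} (some_word {6, 7} (some_word {8} (some_word {4}
     (Conj (same_value n (count_track 6 {4}) (count_track 3 {9 + i}))
     (Conj (same_value n (count_track 6 {5}) (count_track 3 {9 + i}))
     (Conj (same_value n (count_track 6 {6}) (count_track 6 {9 + j}))
     (Conj (same_value n (count_track 6 {6, 7, 9 + k}) (count_track 6 {9 + l}))
     (Conj (same_value n (count_track 6 {8}) (count_track 3 {}))
     (same_value n shift_track plain_track)))))))))"

lemma pctl_atom_formula: "9 \<le> n \<Longrightarrow> pctl_state (gadget_AP n) (atom_formula n i j k l)"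
  unfolding atom_formula_def by (auto intro!: pctl_some_word pctl_same_value)

lemma lists_singleton_iff: "w \<in> lists {a} \<longleftrightarrow> (\<exists>m. w = replicate m a)"
  by (auto simp: in_lists_conv_set) (metis replicate_length_same)

lemma filter_mem_lists:
  "w \<in> lists B \<Longrightarrow> B \<subseteq> A \<Longrightarrow> filter (\<lambda>l. l \<in> A) w = w"
  by (induction w) auto

lemma gsat_atom_formula:
  assumes n: "9 \<le> n" and \<beta>: "\<beta> \<in> lists {9..<n}"
  shows "gsat n (atom_formula n i j k l) (conf (\<beta> @ [0])) \<longleftrightarrow>
    Suc (count_list \<beta> (9 + i)) * count_list \<beta> (9 + j) + count_list \<beta> (9 + k) = count_list \<beta> (9 + l)"
proof -
  let ?\<alpha> = "\<lambda>u h w u'. replicate u 4 @ replicate h 8 @ w @ replicate u' 5 @ \<beta>"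
  let ?x = "Suc (count_list \<beta> (9 + i))"
  have len: "length (filter (\<lambda>l. l \<in> {a}) v) = count_list v a" for a :: nat and v
    by (induction v) auto
  have \<beta>0: "count_list \<beta> a = 0" if "a < 9" for a
    using \<beta> that by (auto simp: count_list_0_iff in_lists_conv_set)
  have rep: "count_list (replicate m b) a = (if a = b then m else 0)" for m and a b :: nat
    by (induction m) auto
  let ?C = "Conj (same_value n (count_track 6 {4}) (count_track 3 {9 + i}))
     (Conj (same_value n (count_track 6 {5}) (count_track 3 {9 + i}))
     (Conj (same_value n (count_track 6 {6}) (count_track 6 {9 + j}))
     (Conj (same_value n (count_track 6 {6, 7, 9 + k}) (count_track 6 {9 + l}))
     (Conj (same_value n (count_track 6 {8}) (count_track 3 {}))
     (same_value n shift_track plain_track)))))"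
  have core: "gsat n ?C (conf (?\<alpha> u h w u' @ [0])) \<longleftrightarrow>
     u = ?x \<and> u' = ?x \<and> count_list w 6 = count_list \<beta> (9 + j) \<and>
     length w + count_list \<beta> (9 + k) = count_list \<beta> (9 + l) \<and> h = 1 \<and>
     2 ^ ?x * bin w + 1 = 2 ^ length w + bin w"
    if w: "w \<in> lists {6, 7}" for u h w u'
  proof -
    have in_n: "?\<alpha> u h w u' \<in> lists {4..<n}"
      using w \<beta> n by (auto simp: in_lists_conv_set)
    then have in_n0: "?\<alpha> u h w u' @ [0] \<in> lists {..<n}"
      using n by (auto simp: in_lists_conv_set)
    have w0: "count_list w a = 0" if "a \<notin> {6, 7}" for a
      using w that by (auto simp: count_list_0_iff in_lists_conv_set)
    have n3: "3 < n" using n by simp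
    have c0: "gsat n (same_value n (count_track 6 A) (count_track 6 B)) (conf (?\<alpha> u h w u' @ [0])) \<longleftrightarrow>
        length (filter (\<lambda>l. l \<in> A) (?\<alpha> u h w u')) = length (filter (\<lambda>l. l \<in> B) (?\<alpha> u h w u'))" for A B
      using gsat_same_count[OF in_n n3, of 0 A B] by simp
    have c1: "gsat n (same_value n (count_track 6 A) (count_track 3 B)) (conf (?\<alpha> u h w u' @ [0])) \<longleftrightarrow>
        length (filter (\<lambda>l. l \<in> A) (?\<alpha> u h w u')) = Suc (length (filter (\<lambda>l. l \<in> B) (?\<alpha> u h w u')))" for A B
      using gsat_same_count[OF in_n n3, of 1 A B] by simp
    have f4: "length (filter (\<lambda>l. l \<in> {6, 7, 9 + k}) (?\<alpha> u h w u')) = length w + count_list \<beta> (9 + k)"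
    proof -
      have "filter (\<lambda>l. l \<in> {6, 7, 9 + k}) w = w"
        using w by (intro filter_mem_lists) auto
      moreover have "filter (\<lambda>l. l \<in> {6, 7, 9 + k}) \<beta> = filter (\<lambda>l. l \<in> {9 + k}) \<beta>"
        using \<beta> by (intro filter_cong) (auto simp: in_lists_conv_set)
      ultimately show ?thesis
        using len[of "9 + k" \<beta>] by simp
    qed
    have "dyadic (track_val shift_track (\<gamma> @ [0]))" if "\<gamma> \<in> lists {4..<n}" for \<gamma>
      using that by (intro dyadic_val) (auto simp: shift_track_def cert_track_def)
    from this[OF in_n] have "dyadic (track_val shift_track (?\<alpha> u h w u' @ [0]))" .
    from gsat_same_value[OF certifying_shift_plain in_n0 n3 this]
    \<comment> \<open>The two tracks express the equation only on stacks of the intended shape,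
      which the other conjuncts enforce.\<close>
    have main: "gsat n (same_value n shift_track plain_track) (conf (?\<alpha> u h w u' @ [0])) \<longleftrightarrow>
      2 ^ ?x * bin w + 1 = 2 ^ length w + bin w" if "u = ?x" "u' = ?x" "h = 1"
      using shift_plain_eq_iff[OF w, of \<beta> ?x] \<beta> that by (simp add: in_lists_conv_set)
    have "gsat n (same_value n (count_track 6 {4}) (count_track 3 {9 + i})) (conf (?\<alpha> u h w u' @ [0])) \<longleftrightarrow> u = ?x"
      unfolding c1 len by (simp add: rep w0 \<beta>0)
    moreover have "gsat n (same_value n (count_track 6 {5}) (count_track 3 {9 + i})) (conf (?\<alpha> u h w u' @ [0])) \<longleftrightarrow> u' = ?x"
      unfolding c1 len by (simp add: rep w0 \<beta>0)
    moreover have "gsat n (same_value n (count_track 6 {6}) (count_track 6 {9 + j})) (conf (?\<alpha> u h w u' @ [0])) \<longleftrightarrow>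
        count_list w 6 = count_list \<beta> (9 + j)"
      unfolding c0 len by (simp add: rep w0 \<beta>0)
    moreover have "gsat n (same_value n (count_track 6 {6, 7, 9 + k}) (count_track 6 {9 + l})) (conf (?\<alpha> u h w u' @ [0])) \<longleftrightarrow>
        length w + count_list \<beta> (9 + k) = count_list \<beta> (9 + l)"
      unfolding c0 f4 len by (simp add: rep w0 \<beta>0)
    moreover have "gsat n (same_value n (count_track 6 {8}) (count_track 3 {})) (conf (?\<alpha> u h w u' @ [0])) \<longleftrightarrow> h = 1"
      unfolding c1 len by (simp add: rep w0 \<beta>0)
    ultimately show ?thesis
      unfolding sat.simps(3) using main by blast
  qed
  have word: "gsat n (some_word B \<Phi>) (conf (v @ \<beta> @ [0])) \<longleftrightarrow> (\<exists>w\<in>lists B. gsat n \<Phi> (conf (w @ v @ \<beta> @ [0])))"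
    if "B \<subseteq> {..<9}" "v \<in> lists {..<9}" for B v \<Phi>
    using that n \<beta> by (intro gsat_some_word) (auto simp: in_lists_conv_set)
  have rep_word: "gsat n (some_word {a} \<Phi>) (conf (v @ \<beta> @ [0])) \<longleftrightarrow>
      (\<exists>u. gsat n \<Phi> (conf (replicate u a @ v @ \<beta> @ [0])))" if "a < 9" "v \<in> lists {..<9}" for a v \<Phi>
    using word[of "{a}" v \<Phi>] that by (auto simp: lists_singleton_iff Bex_def)
  have v: "w @ replicate u' 5 \<in> lists {..<9}" "replicate h 8 @ w @ replicate u' 5 \<in> lists {..<9}"
    if "w \<in> lists {6, 7}" for h u' and w :: "nat list"
    using that by (auto simp: in_lists_conv_set)
  have s4: "gsat n (some_word {4} \<Phi>) (conf (replicate h 8 @ w @ replicate u' 5 @ \<beta> @ [0])) \<longleftrightarrow>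
      (\<exists>u. gsat n \<Phi> (conf (?\<alpha> u h w u' @ [0])))" if "w \<in> lists {6, 7}" for \<Phi> h w u'
    using rep_word[OF _ v(2)[OF that, of h u'], of 4 \<Phi>] by simp
  have s8: "gsat n (some_word {8} \<Phi>) (conf (w @ replicate u' 5 @ \<beta> @ [0])) \<longleftrightarrow>
      (\<exists>h. gsat n \<Phi> (conf (replicate h 8 @ w @ replicate u' 5 @ \<beta> @ [0])))" if "w \<in> lists {6, 7}" for \<Phi> w u'
    using rep_word[OF _ v(1)[OF that, of u'], of 8 \<Phi>] by simp
  have s6: "gsat n (some_word {6, 7} \<Phi>) (conf (replicate u' 5 @ \<beta> @ [0])) \<longleftrightarrow>
      (\<exists>w\<in>lists {6, 7}. gsat n \<Phi> (conf (w @ replicate u' 5 @ \<beta> @ [0])))" for \<Phi> u'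
    using word[of "{6, 7}" "replicate u' 5"] by (auto simp: in_lists_conv_set[of _ "{..<9}"])
  have s5: "gsat n (some_word {5} \<Phi>) (conf (\<beta> @ [0])) \<longleftrightarrow>
      (\<exists>u'. gsat n \<Phi> (conf (replicate u' 5 @ \<beta> @ [0])))" for \<Phi>
    using rep_word[of 5 "[]" \<Phi>] by simp
  have "gsat n (atom_formula n i j k l) (conf (\<beta> @ [0])) \<longleftrightarrow>
      (\<exists>u'. \<exists>w\<in>lists {6, 7}. \<exists>h u. gsat n ?C (conf (?\<alpha> u h w u' @ [0])))"
    unfolding atom_formula_def s5 s6 using s8 s4 by (metis (no_types, lifting))
  also have "\<dots> \<longleftrightarrow>
    (\<exists>u'. \<exists>w\<in>lists {6, 7}. \<exists>h :: nat. \<exists>u. u = ?x \<and> u' = ?x \<and> count_list w 6 = count_list \<beta> (9 + j) \<and>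
     length w + count_list \<beta> (9 + k) = count_list \<beta> (9 + l) \<and> h = 1 \<and>
     2 ^ ?x * bin w + 1 = 2 ^ length w + bin w)"
    by (rule ex_cong1, rule bex_cong[OF refl], rule ex_cong1, rule ex_cong1, rule core)
  also have "\<dots> \<longleftrightarrow> ?x * count_list \<beta> (9 + j) + count_list \<beta> (9 + k) = count_list \<beta> (9 + l)"
    using periodic_bin[of ?x] periodic_bin_exists[of ?x "count_list \<beta> (9 + j)"]
    by (metis zero_less_Suc)
  finally show ?thesis .
qed

section \<open>Translation of arithmetic into PCTL\<close>

fun pctl_of :: "nat \<Rightarrow> nat \<Rightarrow> fm \<Rightarrow> nat state_formula" where
  "pctl_of n d (FAtom i j k l) = atom_formula n i j k l"
| "pctl_of n d (FNot \<phi>) = Neg (pctl_of n d \<phi>)"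
| "pctl_of n d (FAnd \<phi> \<psi>) = Conj (pctl_of n d \<phi>) (pctl_of n d \<psi>)"
| "pctl_of n d (FEx \<phi>) = some_word {9 + d} (pctl_of n (Suc d) \<phi>)"

primrec qdepth :: "fm \<Rightarrow> nat" where
  "qdepth (FAtom i j k l) = 0"
| "qdepth (FNot \<phi>) = qdepth \<phi>"
| "qdepth (FAnd \<phi> \<psi>) = max (qdepth \<phi>) (qdepth \<psi>)"
| "qdepth (FEx \<phi>) = Suc (qdepth \<phi>)"

lemma pctl_pctl_of: "9 + d + qdepth \<phi> \<le> n \<Longrightarrow> pctl_state (gadget_AP n) (pctl_of n d \<phi>)"
  by (induction \<phi> arbitrary: d) (auto simp: pctl_atom_formula intro!: pctl_some_word)

text \<open>The environment is read off the stack, so variables not yet bound have the value 0;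
  \<open>n\<close> reserves a letter for each nested quantifier.\<close>

lemma gsat_pctl_of:
  assumes "9 + d + qdepth \<phi> \<le> n" "\<beta> \<in> lists {9..<9 + d}" "\<And>i. e i = count_list \<beta> (9 + i)"
  shows "gsat n (pctl_of n d \<phi>) (conf (\<beta> @ [0])) \<longleftrightarrow> holds \<phi> d e"
  using assms
proof (induction \<phi> arbitrary: d \<beta> e)
  case (FAtom i j k l)
  then have "\<beta> \<in> lists {9..<n}" "9 \<le> n"
    by (auto simp: in_lists_conv_set)
  then show ?case
    using FAtom by (simp add: gsat_atom_formula)
next
  case (FEx \<phi>)
  have rep: "count_list (replicate m b) a = (if a = b then m else 0)" for m and a b :: nat
    by (induction m) auto
  have "\<beta> @ [0] \<in> lists {..<n}"
    using FEx.prems by (auto simp: in_lists_conv_set)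
  then have "gsat n (pctl_of n d (FEx \<phi>)) (conf (\<beta> @ [0])) \<longleftrightarrow>
      (\<exists>m. gsat n (pctl_of n (Suc d) \<phi>) (conf ((replicate m (9 + d) @ \<beta>) @ [0])))"
    using FEx.prems by (simp add: gsat_some_word Bex_def lists_singleton_iff) blast
  also have "\<dots> \<longleftrightarrow> (\<exists>m. holds \<phi> (Suc d) (e(d := m)))"
  proof (rule ex_cong1, rule FEx.IH)
    fix m
    \<comment> \<open>The letter of the bound variable does not occur yet, so m new copies give it
      exactly the value m.\<close>
    have "count_list \<beta> (9 + d) = 0"
      using FEx.prems by (auto simp: count_list_0_iff in_lists_conv_set)
    then show "(e(d := m)) i = count_list (replicate m (9 + d) @ \<beta>) (9 + i)" for i
      using FEx.prems by (auto simp: rep)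
    show "9 + Suc d + qdepth \<phi> \<le> n" "replicate m (9 + d) @ \<beta> \<in> lists {9..<9 + Suc d}"
      using FEx.prems by (auto simp: in_lists_conv_set)
  qed
  finally show ?case
    by simp
next
  case (FNot \<phi>)
  show ?case
    using FNot.IH[OF _ FNot.prems(2,3)] FNot.prems(1) by simp
next
  case (FAnd \<phi> \<psi>)
  show ?case
    using FAnd.IH(1)[OF _ FAnd.prems(2,3)] FAnd.IH(2)[OF _ FAnd.prems(2,3)] FAnd.prems(1) by simp
qed

section \<open>Diagonalisation\<close>

lemma computes_Comp1: "computes g xs y \<Longrightarrow> computes f [y] z \<Longrightarrow> computes (Comp f [g]) xs z"
  by (rule computes.comp[of _ _ "[y]"]) simp_all

lemma computes_Comp2:
  "computes g xs y \<Longrightarrow> computes h xs y' \<Longrightarrow> computes f [y, y'] z \<Longrightarrow> computes (Comp f [g, h]) xs z"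
  by (rule computes.comp[of _ _ "[y, y']"]) simp_all

lemma computes_Proj: "i < length xs \<Longrightarrow> xs ! i = y \<Longrightarrow> computes (Proj i) xs y"
  using computes.proj by blast

primrec recf_const :: "nat \<Rightarrow> recf" where
  "recf_const 0 = Zero"
| "recf_const (Suc k) = Comp Succ [recf_const k]"

lemma computes_const: "computes (recf_const k) xs k"
  by (induction k) (auto intro: computes_Comp1 computes.zero computes.succ)

definition recf_add :: recf where
  "recf_add = PrimRec (Proj 0) (Comp Succ [Proj 1])"

lemma computes_add: "computes recf_add [m, n] (m + n)"
  unfolding recf_add_def
proof (induction m)
  case (Suc m)
  have "computes (Comp Succ [Proj 1]) [m, m + n, n] (Suc m + n)"
    using computes.succ[of "m + n"] by (intro computes_Comp1[where y = "m + n"] computes_Proj) auto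
  with Suc show ?case
    by (rule computes.primrec_Suc)
qed (simp add: computes.primrec_0 computes_Proj)

definition recf_triangle :: recf where
  "recf_triangle = PrimRec Zero (Comp recf_add [Proj 1, Comp Succ [Proj 0]])"

lemma computes_triangle: "computes recf_triangle [n] (triangle n)"
  unfolding recf_triangle_def
proof (induction n)
  case (Suc n)
  have "computes (Comp recf_add [Proj 1, Comp Succ [Proj 0]]) [n, triangle n] (triangle n + Suc n)"
    by (rule computes_Comp2[OF computes_Proj computes_Comp1[OF computes_Proj computes.succ] computes_add]) simp_all
  with Suc show ?case
    by (auto intro: computes.primrec_Suc)
qed (simp add: computes.primrec_0 computes.zero)

text \<open>\<open>list_encode (x # xs)\<close> is the successor of
  \<open>prod_encode (x, list_encode xs)\<close>, and \<open>prod_encode (x, y)\<close> is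
  \<open>triangle (x + y) + x\<close>.\<close>

definition recf_cons :: "nat \<Rightarrow> recf" where
  "recf_cons x = Comp Succ [Comp recf_add [Comp recf_triangle [Comp recf_add [recf_const x, Proj 0]], recf_const x]]"

lemma computes_cons: "computes (recf_cons x) [list_encode xs] (list_encode (x # xs))"
proof -
  let ?l = "list_encode xs"
  have "computes (Comp recf_triangle [Comp recf_add [recf_const x, Proj 0]]) [?l] (triangle (x + ?l))"
    by (rule computes_Comp1[OF computes_Comp2[OF computes_const computes_Proj computes_add] computes_triangle]) simp_all
  then have "computes (recf_cons x) [?l] (Suc (triangle (x + ?l) + x))"
    unfolding recf_cons_def
    by (rule computes_Comp1[OF computes_Comp2[OF _ computes_const computes_add] computes.succ])
  then show ?thesis
    by (simp add: prod_encode_def)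
qed

definition recf_replicate :: "nat \<Rightarrow> recf" where
  "recf_replicate x = PrimRec (Proj 0) (Comp (recf_cons x) [Proj 1])"

lemma computes_replicate:
  "computes (recf_replicate x) [m, list_encode xs] (list_encode (replicate m x @ xs))"
  unfolding recf_replicate_def
proof (induction m)
  case (Suc m)
  have "computes (Comp (recf_cons x) [Proj 1]) [m, list_encode (replicate m x @ xs), list_encode xs]
      (list_encode (x # replicate m x @ xs))"
    by (rule computes_Comp1[OF computes_Proj computes_cons]) simp_all
  with Suc show ?case
    by (simp only: replicate_Suc append_Cons computes.primrec_Suc)
qed (simp add: computes.primrec_0 computes_Proj)

text \<open>The arguments are the three codes. Letters 9, 10, 11 carry the variables 0, 1, 2, so the
  diagonal formula reads the same codes back from this stack.\<close>

definition recf_conf :: recf where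
  "recf_conf = Comp (recf_cons ctrl) [Comp (recf_replicate (letter 9)) [Proj 0,
     Comp (recf_replicate (letter 10)) [Proj 1,
     Comp (recf_replicate (letter 11)) [Proj 2, recf_const (list_encode [letter 0])]]]]"

lemma computes_conf:
  "computes recf_conf [a, b, c] (list_encode (conf (replicate a 9 @ replicate b 10 @ replicate c 11 @ [0])))"
proof -
  let ?xs = "[a, b, c]"
  have "computes (Comp (recf_replicate (letter 11)) [Proj 2, recf_const (list_encode [letter 0])]) ?xs
      (list_encode (replicate c (letter 11) @ [letter 0]))"
    by (rule computes_Comp2[OF computes_Proj computes_const computes_replicate]) simp_all
  then have "computes (Comp (recf_replicate (letter 10)) [Proj 1,
     Comp (recf_replicate (letter 11)) [Proj 2, recf_const (list_encode [letter 0])]]) ?xs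
      (list_encode (replicate b (letter 10) @ replicate c (letter 11) @ [letter 0]))"
    by (rule computes_Comp2[OF computes_Proj _ computes_replicate, rotated 2]) simp_all
  then have "computes (Comp (recf_replicate (letter 9)) [Proj 0, Comp (recf_replicate (letter 10)) [Proj 1,
     Comp (recf_replicate (letter 11)) [Proj 2, recf_const (list_encode [letter 0])]]]) ?xs
      (list_encode (replicate a (letter 9) @ replicate b (letter 10) @ replicate c (letter 11) @ [letter 0]))"
    by (rule computes_Comp2[OF computes_Proj _ computes_replicate, rotated 2]) simp_all
  then show ?thesis
    unfolding recf_conf_def conf_def map_append map_replicate list.map
    by (rule computes_Comp1[OF _ computes_cons])
qed

theorem theorem1:
  "\<not> (\<exists>decider :: recf. \<forall>(D :: nat pbpa) (AP :: nat set) \<nu> \<gamma> \<Psi>.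
        is_pbpa D \<longrightarrow> finite AP \<longrightarrow>
        simple_assignment (alphabet D) AP \<nu> \<longrightarrow> regular_assignment (alphabet D) AP \<nu> \<longrightarrow>
        \<gamma> \<in> lists (alphabet D) \<longrightarrow> pctl_state AP \<Psi> \<longrightarrow>
        computes decider
          [pbpa_encode D, assignment_encode (alphabet D) AP \<nu>, list_encode \<gamma>, state_formula_encode \<Psi>]
          (if sat (pbpa_chain D) \<nu> \<Psi> \<gamma> then 1 else 0))"
proof
  assume "\<exists>decider :: recf. \<forall>(D :: nat pbpa) (AP :: nat set) \<nu> \<gamma> \<Psi>.
        is_pbpa D \<longrightarrow> finite AP \<longrightarrow>
        simple_assignment (alphabet D) AP \<nu> \<longrightarrow> regular_assignment (alphabet D) AP \<nu> \<longrightarrow>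
        \<gamma> \<in> lists (alphabet D) \<longrightarrow> pctl_state AP \<Psi> \<longrightarrow>
        computes decider
          [pbpa_encode D, assignment_encode (alphabet D) AP \<nu>, list_encode \<gamma>, state_formula_encode \<Psi>]
          (if sat (pbpa_chain D) \<nu> \<Psi> \<gamma> then 1 else 0)"
  then obtain decider where decider: "\<And>(D :: nat pbpa) (AP :: nat set) \<nu> \<gamma> \<Psi>.
        is_pbpa D \<Longrightarrow> finite AP \<Longrightarrow> simple_assignment (alphabet D) AP \<nu> \<Longrightarrow>
        \<gamma> \<in> lists (alphabet D) \<Longrightarrow> pctl_state AP \<Psi> \<Longrightarrow>
        computes decider
          [pbpa_encode D, assignment_encode (alphabet D) AP \<nu>, list_encode \<gamma>, state_formula_encode \<Psi>]
          (if sat (pbpa_chain D) \<nu> \<Psi> \<gamma> then 1 else 0)"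
    using simple_imp_regular_assignment by metis
  \<comment> \<open>\<open>F\<close> asks the decider about the instance with the given codes,
    started on the stack that stores them. It does not mention the size of the alphabet, which can
    therefore be chosen after \<phi>.\<close>
  define F where "F = Comp decider [Proj 0, Proj 1, recf_conf, Proj 2]"
  have "arith 3 (\<lambda>e. \<exists>z. z = 0 \<and> computes F [e 0, e 1, e 2] z)"
    by (rule arith_ex[OF arith_conj[OF arith_zero[of _ 3] arith_computes[of "[0, 1, 2]" _ 3 F]]]) auto
  then obtain \<phi> where \<phi>: "holds \<phi> 3 e \<longleftrightarrow> computes F [e 0, e 1, e 2] 0" for e
    unfolding arith_def by auto
  \<comment> \<open>Twelve letters serve as bottom marker, certificate digits, auxiliary letters and
    the three parameters; each nested quantifier takes one more.\<close>
  define n where "n = 12 + qdepth \<phi>"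
  define \<Psi> where "\<Psi> = pctl_of n 3 \<phi>"
  define a where "a = pbpa_encode (gadget n)"
  define b where "b = assignment_encode (gadget_alphabet n) (gadget_AP n) (gadget_val n)"
  define c where "c = state_formula_encode \<Psi>"
  define \<beta> :: "nat list" where "\<beta> = replicate a 9 @ replicate b 10 @ replicate c 11"
  let ?\<gamma> = "conf (\<beta> @ [0])"
  have rep: "count_list (replicate m y) x = (if x = y then m else 0)" for m and x y :: nat
    by (induction m) auto
  have \<beta>: "\<beta> \<in> lists {9..<9 + 3}"
    by (auto simp: \<beta>_def in_lists_conv_set)
  then have \<beta>n: "\<beta> @ [0] \<in> lists {..<n}"
    by (auto simp: n_def in_lists_conv_set)
  have "gsat n \<Psi> ?\<gamma> \<longleftrightarrow> holds \<phi> 3 (\<lambda>i. count_list \<beta> (9 + i))"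
    unfolding \<Psi>_def using \<beta> by (intro gsat_pctl_of) (auto simp: n_def)
  also have "\<dots> \<longleftrightarrow> computes F [a, b, c] 0"
    by (simp add: \<phi> \<beta>_def rep)
  finally have sat_iff: "gsat n \<Psi> ?\<gamma> \<longleftrightarrow> computes F [a, b, c] 0" .
  have "computes decider [a, b, list_encode ?\<gamma>, c] (if gsat n \<Psi> ?\<gamma> then 1 else 0)"
    unfolding a_def b_def c_def using conf_in_lists[OF \<beta>n]
      decider[OF is_pbpa_gadget finite_gadget_AP, where n1 = n and n2 = n and \<nu> = "gadget_val n" and \<gamma> = ?\<gamma> and \<Psi> = \<Psi>]
    by (simp add: simple_gadget_val \<Psi>_def pctl_pctl_of n_def)
  moreover have "computes recf_conf [a, b, c] (list_encode ?\<gamma>)"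
    using computes_conf[of a b c] by (simp add: \<beta>_def)
  ultimately have "computes F [a, b, c] (if gsat n \<Psi> ?\<gamma> then 1 else 0)"
    unfolding F_def by (intro computes.comp[of _ _ "[a, b, list_encode ?\<gamma>, c]"]) (auto intro: computes_Proj)
  \<comment> \<open>If \<Psi> holds, \<open>F\<close> has the value 0 by \<open>sat_iff\<close> and
    1 by the decider. If it fails, the decider gives \<open>F\<close> the value 0, and
    \<open>sat_iff\<close> makes \<Psi> hold.\<close>
  then show False
    using sat_iff computes_functional by (metis zero_neq_one)
qed

end
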